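(* Let $0<\alpha<n$, $0<p<\frac n\alpha$, and $\frac1q=\frac1p-\frac\alpha n$. If $w$ is a weight on $\mathbb{R}^n$ with $w^p\in RH_{\frac qp}$, then there is a constant $C$ such that for any countable collection of cubes $\{Q_k\}$ and any $\lambda_k>0$, $$\left\|\sum_k\lambda_k|Q_k|^{\frac\alpha n}\chi_{Q_k}\right\|_{L^q(w^q)}\le C\left\|\sum_k\lambda_k\chi_{Q_k}\right\|_{L^p(w^p)}.$$
   Context: Cubes have sides parallel to the coordinate axes. A weight is a non-negative locally integrable function $w$ with $0<w<\infty$ a.e. For $1<s<\infty$, $v\in RH_s$ if there is $C$ with $\left(\frac1{|Q|}\int_Q v^s\,dx\right)^{1/s}\le C\,\frac1{|Q|}\int_Q v\,dx$ for every cube $Q$. $\|f\|_{L^p(v)}=\left(\int_{\mathbb{R}^n}|f|^pv\,dx\right)^{1/p}$. *)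

theory Defs
  imports "HOL-Analysis.Analysis"
begin

text \<open>Non-negative functions take values in \<^typ>\<open>ennreal\<close>: a weight may be infinite on
  a null set, and the sum of a countable family of multiples of characteristic functions may be
  infinite at some points. Only exponents \<^term>\<open>a > 0\<close> are used, for which
  \<open>0 powr a = 0\<close> and \<open>\<infinity>\<close> to the power \<open>a\<close> is \<open>\<infinity>\<close>.\<close>

definition epowr :: "ennreal \<Rightarrow> real \<Rightarrow> ennreal" where
  "epowr x a = (if x = \<infinity> then \<infinity> else ennreal (enn2real x powr a))"

definition is_cube :: "(real ^ 'n) set \<Rightarrow> bool" where
  "is_cube Q \<longleftrightarrow> (\<exists>a l. 0 < l \<and> Q = cbox a (a + (\<chi> i. l)))"

definition average :: "(real ^ 'n) set \<Rightarrow> (real ^ 'n \<Rightarrow> ennreal) \<Rightarrow> ennreal" where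
  "average Q f = (\<integral>\<^sup>+x\<in>Q. f x \<partial>lebesgue) / emeasure lebesgue Q"

definition weight :: "(real ^ 'n \<Rightarrow> ennreal) \<Rightarrow> bool" where
  "weight w \<longleftrightarrow>
     w \<in> borel_measurable lebesgue \<and>
     (\<forall>K. compact K \<longrightarrow> (\<integral>\<^sup>+x\<in>K. w x \<partial>lebesgue) < \<infinity>) \<and>
     (AE x in lebesgue. 0 < w x \<and> w x < \<infinity>)"

text \<open>As usual, membership in a reverse Hoelder class includes being a weight; in particular the
  averages on the right-hand side below are finite. Intended for \<^term>\<open>1 < s\<close>.\<close>

definition RH :: "real \<Rightarrow> (real ^ 'n \<Rightarrow> ennreal) set" where
  "RH s = {v. weight v \<and>
     (\<exists>C::real. \<forall>Q. is_cube Q \<longrightarrow>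
        epowr (average Q (\<lambda>x. epowr (v x) s)) (1 / s) \<le> ennreal C * average Q v)}"

text \<open>The functional \<open>\<parallel>f\<parallel>\<close> of \<open>L\<^sup>p(v)\<close> for non-negative \<open>f\<close> (only a quasi-norm when
  \<^term>\<open>p < 1\<close>), with values in \<open>[0, \<infinity>]\<close>.\<close>

definition Lp_norm :: "real \<Rightarrow> (real ^ 'n \<Rightarrow> ennreal) \<Rightarrow> (real ^ 'n \<Rightarrow> ennreal) \<Rightarrow> ennreal" where
  "Lp_norm p v f = epowr (\<integral>\<^sup>+x. epowr (f x) p * v x \<partial>lebesgue) (1 / p)"

end

theory Submission
  imports Defs
begin

text \<open>Write \<open>v = w\<^sup>p\<close>, \<open>s = q / p > 1\<close> and \<open>\<gamma> = \<alpha> / n = 1/p - 1/q\<close>, so that \<open>w\<^sup>q = v\<^sup>s\<close> and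
  \<open>v\<close> satisfies a reverse Hoelder inequality with exponent \<open>s\<close>. By monotone convergence it is enough to
  treat finitely many cubes, with a constant that does not depend on their number. The proof has two
  ingredients, both valid for all positive exponents, so that \<open>p < 1\<close> or \<open>q < 1\<close> is no special case.

  The first one (\<open>nested_stretch\<close>) compares two sums. Let \<open>R\<^sub>k\<close> be sets any two of which are disjoint
  or nested, and let \<open>E\<^sub>k \<subseteq> R\<^sub>k\<close> carry a fixed fraction of the mass of \<open>R\<^sub>k\<close> for some measure. Then the
  quasi-norms in \<open>L\<^sup>r\<close> of \<open>\<Sum> c\<^sub>k \<chi>\<^bsub>R\<^sub>k\<^esub>\<close> and \<open>\<Sum> c\<^sub>k \<chi>\<^bsub>E\<^sub>k\<^esub>\<close> are comparable. Indeed, with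
  \<open>B\<^sub>k = \<Sum> {c\<^sub>i | R\<^sub>k \<subseteq> R\<^sub>i}\<close>, telescoping along the chain of all \<open>R\<^sub>k\<close> containing a point shows that the
  \<open>r\<close>-th power of the sum is comparable to \<open>\<Sum> c\<^sub>k B\<^sub>k\<^sup>r\<^sup>-\<^sup>1 \<chi>\<^bsub>R\<^sub>k\<^esub>\<close>, an expression linear in the
  indicators, whose coefficients do not change when \<open>R\<^sub>k\<close> is replaced by \<open>E\<^sub>k\<close>.

  The second one (\<open>hedberg_pointwise\<close>) is a pointwise bound in the spirit of Hedberg. Put
  \<open>f = \<Sum> c\<^sub>k \<chi>\<^bsub>R\<^sub>k\<^esub>\<close> and \<open>N = \<integral> f\<^sup>p v\<close>. Since \<open>f \<ge> B\<^sub>k\<close> on \<open>R\<^sub>k\<close>, the mass \<open>v(R\<^sub>k)\<close> is at most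
  \<open>N B\<^sub>k\<^sup>-\<^sup>p\<close>. If \<open>x\<close> lies in the part \<open>E\<^sub>k\<close> of \<open>R\<^sub>k\<close> where \<open>v\<close> is at most \<open>M\<close> (the constant \<open>tail_level\<close>)
  times its mean, then
  \<open>v(x) |R\<^sub>k| \<le> M v(R\<^sub>k)\<close>, and so \<open>|R\<^sub>k|\<^sup>\<gamma>\<close> is at most \<open>(M N / v(x))\<^sup>\<gamma>\<close> times the power of \<open>B\<^sub>k\<close> with
  exponent \<open>p/q - 1\<close>. The same telescoping, now with exponent \<open>p/q\<close>, gives
  \<open>\<Sum> c\<^sub>k |R\<^sub>k|\<^sup>\<gamma> \<chi>\<^bsub>E\<^sub>k\<^esub> \<le> (q/p) (M N / v)\<^sup>\<gamma> f\<^sup>p\<^sup>/\<^sup>q\<close>. The \<open>q\<close>-th power of the right-hand side times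
  \<open>v\<^sup>s\<close> is a constant multiple of \<open>N\<^sup>s\<^sup>-\<^sup>1 f\<^sup>p v\<close>, whose integral is \<open>N\<^sup>s\<close>.

  To combine them, place every cube \<open>Q\<^sub>k\<close> in a cell \<open>R\<^sub>k\<close> of comparable size of one of \<open>2\<^sup>n\<close> translated
  dyadic grids (\<open>cubes_in_shifted_grids\<close>) and treat each grid separately (\<open>one_grid\<close>). The first ingredient is
  used with the measure \<open>v dx\<close> to pass from \<open>Q\<^sub>k\<close> to \<open>R\<^sub>k\<close> on the right-hand side, and with
  \<open>v\<^sup>s dx\<close> to pass from \<open>R\<^sub>k\<close> to \<open>E\<^sub>k\<close> on the left-hand side. The mass comparisons that
  it needs, namely that \<open>v\<close> is doubling (\<open>V_doubling\<close>) and that \<open>E\<^sub>k\<close> is large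
  (\<open>U_le_of_bounded_part\<close>), both rest on \<open>V_tail\<close>: by the reverse Hoelder inequality, at most a quarter of
  the mass of \<open>v\<close> on a cube sits where \<open>v\<close> exceeds \<open>M\<close> times its mean.\<close>

section \<open>Power sums along chains\<close>

text \<open>The graph of a concave power lies below its tangent at 1; this is Young's inequality with one of the
  two factors equal to 1.\<close>

lemma powr_le_tangent:
  fixes t r :: real
  assumes "0 \<le> t" "0 < r" "r \<le> 1"
  shows "t powr r \<le> 1 + r * (t - 1)"
  using Youngs_inequality_0[of r "1 - r" t 1] assms by (cases "t = 0") (simp_all add: algebra_simps)

lemma powr_ge_tangent:
  fixes t r :: real
  assumes "0 \<le> t" "1 \<le> r"
  shows "1 + r * (t - 1) \<le> t powr r"
proof -
  have "(t powr r) powr (1 / r) \<le> 1 + (1 / r) * (t powr r - 1)"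
    using assms by (intro powr_le_tangent) auto
  hence "t \<le> 1 + (1 / r) * (t powr r - 1)"
    using assms by (simp add: powr_powr)
  thus ?thesis using assms by (simp add: field_simps)
qed

text \<open>This and its counterpart for \<open>1 \<le> r\<close> are discrete derivatives of \<open>S\<^sup>r\<close>, taken at the upper end
  point \<open>S\<close> of the increment: there the coefficient \<open>c S\<^sup>r\<^sup>-\<^sup>1\<close> matches the sum over everything above a member
  of a chain, that member included.\<close>

lemma powr_increment_ge:
  fixes S c r :: real
  assumes "0 < c" "c \<le> S" "0 < r" "r \<le> 1"
  shows "r * c * S powr (r - 1) \<le> S powr r - (S - c) powr r"
proof -
  have S: "0 < S" using assms by simp
  have "((S - c) / S) powr r \<le> 1 + r * ((S - c) / S - 1)"
    using assms by (intro powr_le_tangent) auto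
  also have "\<dots> = 1 - r * c / S" using S by (simp add: field_simps)
  finally have "(S - c) powr r \<le> (1 - r * c / S) * S powr r"
    using S by (simp add: powr_divide pos_divide_le_eq)
  also have "\<dots> = S powr r - r * c * (S powr r / S)" by (simp add: field_simps)
  also have "S powr r / S = S powr (r - 1)" using S by (simp add: powr_diff)
  finally show ?thesis by simp
qed

lemma powr_increment_le:
  fixes S c r :: real
  assumes "0 < c" "c \<le> S" "1 \<le> r"
  shows "S powr r - (S - c) powr r \<le> r * c * S powr (r - 1)"
proof -
  have S: "0 < S" using assms by simp
  have "1 - r * c / S = 1 + r * ((S - c) / S - 1)" using S by (simp add: field_simps)
  also have "\<dots> \<le> ((S - c) / S) powr r"
    using assms by (intro powr_ge_tangent) auto
  finally have "(1 - r * c / S) * S powr r \<le> (S - c) powr r"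
    using S by (simp add: powr_divide pos_le_divide_eq)
  moreover have "(1 - r * c / S) * S powr r = S powr r - r * c * (S powr r / S)"
    by (simp add: field_simps)
  moreover have "S powr r / S = S powr (r - 1)" using S by (simp add: powr_diff)
  ultimately show ?thesis by simp
qed

text \<open>Induction over a finite chain that adds the smallest set last. Equal sets are allowed, so
  \<open>R\<close> need not be injective.\<close>

lemma chain_induct [consumes 2, case_names empty insert]:
  assumes "finite A" "\<forall>i\<in>A. \<forall>j\<in>A. R i \<subseteq> R j \<or> R j \<subseteq> R i"
    and "P {}"
    and "\<And>A k. finite A \<Longrightarrow> k \<notin> A \<Longrightarrow> (\<And>i. i \<in> A \<Longrightarrow> R k \<subseteq> R i) \<Longrightarrow> P A \<Longrightarrow> P (insert k A)"
  shows "P A"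
  using assms(1,2)
proof (induction A rule: finite_psubset_induct)
  case (psubset A)
  show ?case
  proof (cases "A = {}")
    case False
    then obtain m where m: "m \<in> R ` A" "\<And>y. y \<in> R ` A \<Longrightarrow> y \<subseteq> m \<Longrightarrow> y = m"
      using finite_has_minimal[of "R ` A"] psubset.hyps by (metis empty_is_image finite_imageI)
    then obtain k where k: "k \<in> A" "m = R k" by auto
    have sub: "R k \<subseteq> R i" if "i \<in> A" for i
      using m(2)[of "R i"] psubset.prems k that by auto
    have "P (A - {k})"
      using psubset k by auto
    hence "P (insert k (A - {k}))"
      using psubset.hyps sub by (intro assms(4)) auto
    thus ?thesis using k by (simp add: insert_absorb)
  qed (use assms(3) in simp)
qed

text \<open>The sum is a lower Riemann sum for \<open>\<integral> r t\<^sup>r\<^sup>-\<^sup>1 dt\<close> from 0 to the total of \<open>c\<close>, because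
  the integrand decreases and is evaluated at the right end points. Adding a smallest set appends the last of
  these intervals; members equal to that set have their inner sum increased, which makes the left-hand side
  smaller still.\<close>

lemma chain_sum_le:
  fixes c :: "'i \<Rightarrow> real"
  assumes "finite A" "\<forall>i\<in>A. \<forall>j\<in>A. R i \<subseteq> R j \<or> R j \<subseteq> R i"
    and "\<forall>i\<in>A. 0 < c i" and "0 < r" "r \<le> 1"
  shows "r * (\<Sum>k\<in>A. c k * (\<Sum>i | i \<in> A \<and> R k \<subseteq> R i. c i) powr (r - 1)) \<le> (\<Sum>k\<in>A. c k) powr r"
  using assms(1-3)
proof (induction A rule: chain_induct)
  case (insert A k)
  let ?B = "\<lambda>A k. \<Sum>i | i \<in> A \<and> R k \<subseteq> R i. c i"
  have c: "0 < c k" "\<And>i. i \<in> A \<Longrightarrow> 0 < c i" using insert.prems by auto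
  have "{i. i \<in> insert k A \<and> R k \<subseteq> R i} = insert k A" using insert.hyps by auto
  hence Bk: "?B (insert k A) k = sum c (insert k A)" by (simp only:)
  have sumA: "0 \<le> sum c A" using c by (intro sum_nonneg) (auto intro: less_imp_le)
  have Ble: "?B (insert k A) i powr (r - 1) \<le> ?B A i powr (r - 1)" if i: "i \<in> A" for i
  proof (rule powr_mono2')
    show "0 < ?B A i"
      using insert.hyps i c by (intro sum_pos) auto
    show "?B A i \<le> ?B (insert k A) i"
      using insert.hyps insert.prems by (intro sum_mono2) (auto intro: less_imp_le)
  qed (use assms in auto)
  have "r * (\<Sum>j\<in>insert k A. c j * ?B (insert k A) j powr (r - 1))
      = r * c k * sum c (insert k A) powr (r - 1)
        + r * (\<Sum>j\<in>A. c j * ?B (insert k A) j powr (r - 1))"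
    by (simp only: sum.insert[OF insert.hyps(1,2)] Bk distrib_left mult.assoc)
  also have "\<dots> \<le> (sum c (insert k A) powr r - (sum c (insert k A) - c k) powr r)
        + r * (\<Sum>j\<in>A. c j * ?B A j powr (r - 1))"
    using insert.hyps c sumA Ble assms
    by (intro add_mono powr_increment_ge mult_left_mono sum_mono) (auto intro: less_imp_le)
  also have "\<dots> \<le> (sum c (insert k A) powr r - (sum c (insert k A) - c k) powr r) + sum c A powr r"
    using insert.IH c by simp
  also have "\<dots> = sum c (insert k A) powr r" using insert.hyps by simp
  finally show ?case .
qed auto

text \<open>For \<open>1 \<le> r\<close> the integrand increases, and the same sum is an upper Riemann sum.\<close>

lemma chain_sum_ge:
  fixes c :: "'i \<Rightarrow> real"
  assumes "finite A" "\<forall>i\<in>A. \<forall>j\<in>A. R i \<subseteq> R j \<or> R j \<subseteq> R i"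
    and "\<forall>i\<in>A. 0 < c i" and "1 \<le> r"
  shows "(\<Sum>k\<in>A. c k) powr r \<le> r * (\<Sum>k\<in>A. c k * (\<Sum>i | i \<in> A \<and> R k \<subseteq> R i. c i) powr (r - 1))"
  using assms(1-3)
proof (induction A rule: chain_induct)
  case (insert A k)
  let ?B = "\<lambda>A k. \<Sum>i | i \<in> A \<and> R k \<subseteq> R i. c i"
  have c: "0 < c k" "\<And>i. i \<in> A \<Longrightarrow> 0 < c i" using insert.prems by auto
  have "{i. i \<in> insert k A \<and> R k \<subseteq> R i} = insert k A" using insert.hyps by auto
  hence Bk: "?B (insert k A) k = sum c (insert k A)" by (simp only:)
  have sumA: "0 \<le> sum c A" using c by (intro sum_nonneg) (auto intro: less_imp_le)
  have Ble: "?B A i powr (r - 1) \<le> ?B (insert k A) i powr (r - 1)" if i: "i \<in> A" for i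
  proof (rule powr_mono2)
    show "0 \<le> ?B A i"
      using insert.hyps i c by (intro sum_nonneg) (auto intro: less_imp_le)
    show "?B A i \<le> ?B (insert k A) i"
      using insert.hyps insert.prems by (intro sum_mono2) (auto intro: less_imp_le)
  qed (use assms in auto)
  have "sum c (insert k A) powr r
      = (sum c (insert k A) powr r - (sum c (insert k A) - c k) powr r) + sum c A powr r"
    using insert.hyps by simp
  also have "\<dots> \<le> (sum c (insert k A) powr r - (sum c (insert k A) - c k) powr r)
        + r * (\<Sum>j\<in>A. c j * ?B A j powr (r - 1))"
    using insert.IH c by simp
  also have "\<dots> \<le> r * c k * sum c (insert k A) powr (r - 1)
        + r * (\<Sum>j\<in>A. c j * ?B (insert k A) j powr (r - 1))"
    using insert.hyps c sumA Ble assms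
    by (intro add_mono powr_increment_le mult_left_mono sum_mono) (auto intro: less_imp_le)
  also have "\<dots> = r * (\<Sum>j\<in>insert k A. c j * ?B (insert k A) j powr (r - 1))"
    by (simp only: sum.insert[OF insert.hyps(1,2)] Bk distrib_left mult.assoc)
  finally show ?case .
qed auto

lemma sum_powr_le:
  fixes f :: "'i \<Rightarrow> real"
  assumes "finite T" "\<And>i. i \<in> T \<Longrightarrow> 0 \<le> f i" "0 < r"
  shows "(\<Sum>i\<in>T. f i) powr r \<le> real (card T) powr r * (\<Sum>i\<in>T. f i powr r)"
proof (cases "T = {}")
  case False
  hence "Max (f ` T) \<in> f ` T" using assms(1) by (intro Max_in) auto
  then obtain j where j: "Max (f ` T) = f j" "j \<in> T" by (rule imageE)
  hence le: "f i \<le> f j" if "i \<in> T" for i using Max_ge[of "f ` T" "f i"] assms(1) that by simp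
  have "(\<Sum>i\<in>T. f i) powr r \<le> (real (card T) * f j) powr r"
    using assms le sum_bounded_above[of T f "f j"] by (intro powr_mono2 sum_nonneg) auto
  also have "\<dots> = real (card T) powr r * f j powr r"
    by (rule powr_mult)
  also have "\<dots> \<le> real (card T) powr r * (\<Sum>i\<in>T. f i powr r)"
    using j(2) assms(1) by (intro mult_left_mono member_le_sum) auto
  finally show ?thesis .
qed simp

section \<open>Shrinking the members of a nested family\<close>

lemma sum_indicator_eq:
  fixes c :: "'i \<Rightarrow> real"
  assumes "finite K"
  shows "(\<Sum>k\<in>K. c k * indicator (R k) x) = (\<Sum>k | k \<in> K \<and> x \<in> R k. c k)"
proof -
  have "(\<Sum>k\<in>K. c k * indicator (R k) x) = (\<Sum>k\<in>K. if x \<in> R k then c k else 0)"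
    by (intro sum.cong) auto
  also have "\<dots> = (\<Sum>k | k \<in> K \<and> x \<in> R k. c k)"
    using assms by (simp add: sum.inter_filter)
  finally show ?thesis .
qed

lemma ennreal_sum_indicator:
  assumes "\<And>k. k \<in> K \<Longrightarrow> 0 \<le> b k"
  shows "ennreal (\<Sum>k\<in>K. b k * indicator (R k) x) = (\<Sum>k\<in>K. ennreal (b k) * indicator (R k) x)"
proof -
  have "(\<Sum>k\<in>K. ennreal (b k) * indicator (R k) x) = (\<Sum>k\<in>K. ennreal (b k * indicator (R k) x))"
    by (intro sum.cong) (auto simp: indicator_def)
  also have "\<dots> = ennreal (\<Sum>k\<in>K. b k * indicator (R k) x)"
    using assms by (intro sum_ennreal) auto
  finally show ?thesis ..
qed

lemma nn_integral_sum_indicator: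
  assumes "\<And>k. k \<in> K \<Longrightarrow> R k \<in> sets M"
  shows "(\<integral>\<^sup>+x. (\<Sum>k\<in>K. ennreal (b k) * indicator (R k) x) \<partial>M) = (\<Sum>k\<in>K. ennreal (b k) * emeasure M (R k))"
proof -
  have "(\<integral>\<^sup>+x. (\<Sum>k\<in>K. ennreal (b k) * indicator (R k) x) \<partial>M)
      = (\<Sum>k\<in>K. \<integral>\<^sup>+x. ennreal (b k) * indicator (R k) x \<partial>M)"
    using assms by (intro nn_integral_sum borel_measurable_times_ennreal borel_measurable_indicator) auto
  also have "\<dots> = (\<Sum>k\<in>K. ennreal (b k) * emeasure M (R k))"
    using assms by (intro sum.cong nn_integral_cmult_indicator) auto
  finally show ?thesis .
qed

lemma measurable_sum_indicator_powr:
  fixes c :: "'i \<Rightarrow> real"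
  assumes "\<And>k. k \<in> K \<Longrightarrow> R k \<in> sets M"
  shows "(\<lambda>x. ennreal ((\<Sum>k\<in>K. c k * indicator (R k) x) powr r)) \<in> borel_measurable M"
proof -
  have [measurable]: "(\<lambda>x. \<Sum>k\<in>K. c k * indicator (R k) x) \<in> borel_measurable M"
    using assms
    by (intro borel_measurable_sum borel_measurable_times borel_measurable_const borel_measurable_indicator)
  show ?thesis by measurable
qed

text \<open>The combinatorial property of dyadic cubes on which the proof relies.\<close>

definition nested :: "'i set \<Rightarrow> ('i \<Rightarrow> 'a set) \<Rightarrow> bool" where
  "nested K R \<longleftrightarrow> (\<forall>i\<in>K. \<forall>j\<in>K. R i \<inter> R j = {} \<or> R i \<subseteq> R j \<or> R j \<subseteq> R i)"

abbreviation sum_above :: "'i set \<Rightarrow> ('i \<Rightarrow> 'a set) \<Rightarrow> ('i \<Rightarrow> real) \<Rightarrow> 'i \<Rightarrow> real" where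
  "sum_above K R c k \<equiv> (\<Sum>i | i \<in> K \<and> R k \<subseteq> R i. c i)"

lemma above_pos:
  assumes "finite K" "\<And>k. k \<in> K \<Longrightarrow> 0 < c k" "k \<in> K"
  shows "0 < sum_above K R c k"
  using assms by (intro sum_pos) auto

text \<open>At a point of \<open>R k\<close> all sets containing \<open>R k\<close> contribute to the sum.\<close>

lemma above_le_sum:
  assumes "finite K" "\<And>k. k \<in> K \<Longrightarrow> 0 < c k" "x \<in> R k"
  shows "sum_above K R c k \<le> (\<Sum>k\<in>K. c k * indicator (R k) x)"
  unfolding sum_indicator_eq[OF assms(1)]
  using assms by (intro sum_mono2) (auto intro: less_imp_le)

text \<open>The inner sums run over all of \<open>K\<close> while only the sets \<open>E k\<close> are counted at \<open>x\<close>. For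
  \<open>r \<le> 1\<close> this is harmless: more terms inside a negative power only decrease the left-hand side.\<close>

lemma sum_above_powr_le:
  fixes c :: "'i \<Rightarrow> real"
  assumes K: "finite K" "nested K R" "\<And>k. k \<in> K \<Longrightarrow> E k \<subseteq> R k" "\<And>k. k \<in> K \<Longrightarrow> 0 < c k"
    and r: "0 < r" "r \<le> 1"
  shows "r * (\<Sum>k\<in>K. c k * sum_above K R c k powr (r - 1) * indicator (E k) x)
    \<le> (\<Sum>k\<in>K. c k * indicator (E k) x) powr r"
proof -
  let ?A = "{k. k \<in> K \<and> x \<in> E k}"
  have "(\<Sum>k\<in>K. c k * sum_above K R c k powr (r - 1) * indicator (E k) x)
      = (\<Sum>k\<in>?A. c k * sum_above K R c k powr (r - 1))"
    using sum_indicator_eq[OF K(1)] .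
  also have "\<dots> \<le> (\<Sum>k\<in>?A. c k * sum_above ?A R c k powr (r - 1))"
  proof (intro sum_mono mult_left_mono powr_mono2')
    fix k assume k: "k \<in> ?A"
    show "0 < sum_above ?A R c k" using k K by (intro above_pos) auto
    show "sum_above ?A R c k \<le> sum_above K R c k"
      using K by (intro sum_mono2) (auto intro: less_imp_le)
    show "0 \<le> c k" using k K by (auto intro: less_imp_le)
  qed (use r in auto)
  finally have "r * (\<Sum>k\<in>K. c k * sum_above K R c k powr (r - 1) * indicator (E k) x)
     \<le> r * (\<Sum>k\<in>?A. c k * sum_above ?A R c k powr (r - 1))"
    using r by simp
  also have "\<dots> \<le> (\<Sum>k\<in>?A. c k) powr r"
  proof (rule chain_sum_le)
    show "\<forall>i\<in>?A. \<forall>j\<in>?A. R i \<subseteq> R j \<or> R j \<subseteq> R i"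
      using K(2,3) unfolding nested_def by blast
  qed (use K r in auto)
  finally show ?thesis unfolding sum_indicator_eq[OF K(1)] .
qed

text \<open>At a point \<open>x\<close> the inner sums automatically run over sets containing \<open>x\<close>, so this is the upper
  bound for chains; when \<open>r < 1\<close> every inner sum is simply at most the full sum.\<close>

lemma sum_powr_le_above:
  fixes c :: "'i \<Rightarrow> real"
  assumes K: "finite K" "nested K R" "\<And>k. k \<in> K \<Longrightarrow> 0 < c k"
    and r: "0 < r"
  shows "(\<Sum>k\<in>K. c k * indicator (R k) x) powr r
    \<le> max 1 r * (\<Sum>k\<in>K. c k * sum_above K R c k powr (r - 1) * indicator (R k) x)"
proof -
  let ?A = "{k. k \<in> K \<and> x \<in> R k}"
  have eq: "sum_above ?A R c k = sum_above K R c k" if "k \<in> ?A" for k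
    using that by (intro sum.cong) auto
  have "(\<Sum>k\<in>?A. c k) powr r \<le> max 1 r * (\<Sum>k\<in>?A. c k * sum_above ?A R c k powr (r - 1))"
  proof (cases "1 \<le> r")
    case True
    have "\<forall>i\<in>?A. \<forall>j\<in>?A. R i \<subseteq> R j \<or> R j \<subseteq> R i"
      using K(2) unfolding nested_def by blast
    hence "(\<Sum>k\<in>?A. c k) powr r \<le> r * (\<Sum>k\<in>?A. c k * sum_above ?A R c k powr (r - 1))"
      using K True by (intro chain_sum_ge) auto
    thus ?thesis using True by (simp add: max_def)
  next
    case False
    show ?thesis
    proof (cases "?A = {}")
      case nonempty: False
      hence pos: "0 < (\<Sum>k\<in>?A. c k)" using K by (intro sum_pos) auto
      have "(\<Sum>k\<in>?A. c k) powr r = (\<Sum>k\<in>?A. c k) * (\<Sum>k\<in>?A. c k) powr (r - 1)"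
        using pos by (simp add: powr_mult_base)
      also have "\<dots> = (\<Sum>k\<in>?A. c k * (\<Sum>k\<in>?A. c k) powr (r - 1))"
        by (simp add: sum_distrib_right)
      also have "\<dots> \<le> (\<Sum>k\<in>?A. c k * sum_above ?A R c k powr (r - 1))"
      proof (intro sum_mono mult_left_mono powr_mono2')
        fix k assume k: "k \<in> ?A"
        show "0 < sum_above ?A R c k" using k K by (intro above_pos) auto
        show "sum_above ?A R c k \<le> (\<Sum>k\<in>?A. c k)"
          using K by (intro sum_mono2) (auto intro: less_imp_le)
        show "0 \<le> c k" using k K by (auto intro: less_imp_le)
      qed (use False in auto)
      finally show ?thesis using False by (simp add: max_def)
    next
      case True
      show ?thesis unfolding True by simp
    qed
  qed
  also have "(\<Sum>k\<in>?A. c k * sum_above ?A R c k powr (r - 1)) = (\<Sum>k\<in>?A. c k * sum_above K R c k powr (r - 1))"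
    using eq by (intro sum.cong) auto
  finally show ?thesis unfolding sum_indicator_eq[OF K(1)] .
qed

text \<open>Young's inequality with a small parameter, proved by comparing \<open>a\<close> with \<open>e b\<close>.\<close>

lemma mult_powr_le_eps:
  fixes a b e r :: real
  assumes "0 \<le> a" "0 \<le> b" "0 < e" "1 \<le> r"
  shows "a * b powr (r - 1) \<le> e * b powr r + e powr (1 - r) * a powr r"
proof (cases "a \<le> e * b")
  case True
  have "a * b powr (r - 1) \<le> e * b * b powr (r - 1)"
    using True by (intro mult_right_mono) auto
  also have "\<dots> = e * b powr r" using assms by (simp add: powr_mult_base)
  finally show ?thesis by (smt (verit) mult_nonneg_nonneg powr_ge_zero)
next
  case False
  have "b powr (r - 1) \<le> (a / e) powr (r - 1)"
    using False assms by (intro powr_mono2) (auto simp: field_simps)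
  also have "\<dots> = a powr (r - 1) * e powr (1 - r)"
    using assms by (simp add: powr_divide powr_diff)
  finally have "a * b powr (r - 1) \<le> a * (a powr (r - 1) * e powr (1 - r))"
    using assms by (intro mult_left_mono)
  also have "\<dots> = e powr (1 - r) * a powr r"
    using assms powr_mult_base[of a "r - 1"] by simp
  finally show ?thesis
    using assms by (smt (verit) mult_nonneg_nonneg powr_ge_zero)
qed

text \<open>The integral of a power of the sum is controlled by an expression that is linear in the masses
  of the \<open>R k\<close>, so that these masses can be compared one at a time.\<close>

lemma nn_integral_nested_sum_powr_le:
  fixes c :: "'i \<Rightarrow> real"
  assumes K: "finite K" "nested K R" "\<And>k. k \<in> K \<Longrightarrow> 0 < c k" "\<And>k. k \<in> K \<Longrightarrow> R k \<in> sets M"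
    and r: "0 < r"
  shows "(\<integral>\<^sup>+x. ennreal ((\<Sum>k\<in>K. c k * indicator (R k) x) powr r) \<partial>M)
    \<le> ennreal (max 1 r) * (\<Sum>k\<in>K. ennreal (c k * sum_above K R c k powr (r - 1)) * emeasure M (R k))"
proof -
  let ?b = "\<lambda>k. c k * sum_above K R c k powr (r - 1)"
  have b: "0 \<le> ?b k" if "k \<in> K" for k using K(3)[OF that] by simp
  have "(\<integral>\<^sup>+x. ennreal ((\<Sum>k\<in>K. c k * indicator (R k) x) powr r) \<partial>M)
      \<le> (\<integral>\<^sup>+x. ennreal (max 1 r) * (\<Sum>k\<in>K. ennreal (?b k) * indicator (R k) x) \<partial>M)"
  proof (rule nn_integral_mono)
    fix x
    have "ennreal ((\<Sum>k\<in>K. c k * indicator (R k) x) powr r)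
        \<le> ennreal (max 1 r * (\<Sum>k\<in>K. ?b k * indicator (R k) x))"
      using sum_powr_le_above[OF K(1-3) r] by (intro ennreal_leI) auto
    also have "\<dots> = ennreal (max 1 r) * ennreal (\<Sum>k\<in>K. ?b k * indicator (R k) x)"
      using b by (intro ennreal_mult) (auto intro!: sum_nonneg)
    also have "ennreal (\<Sum>k\<in>K. ?b k * indicator (R k) x) = (\<Sum>k\<in>K. ennreal (?b k) * indicator (R k) x)"
      using b by (rule ennreal_sum_indicator)
    finally show "ennreal ((\<Sum>k\<in>K. c k * indicator (R k) x) powr r)
        \<le> ennreal (max 1 r) * (\<Sum>k\<in>K. ennreal (?b k) * indicator (R k) x)" .
  qed
  also have "\<dots> = ennreal (max 1 r) * (\<Sum>k\<in>K. ennreal (?b k) * emeasure M (R k))"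
    using K(4) by (subst nn_integral_cmult) (simp_all add: nn_integral_sum_indicator borel_measurable_sum)
  finally show ?thesis .
qed

text \<open>The two summands serve the cases \<open>r \<le> 1\<close> and \<open>r > 1\<close>.\<close>

definition stretch_const :: "real \<Rightarrow> real \<Rightarrow> real" where
  "stretch_const C r = C / r + (2 * r * C) powr r"

text \<open>Linearise the left-hand side, replace each mass of \<open>R k\<close> by that of \<open>E k\<close>, and bound the
  resulting integral over the sets \<open>E k\<close> pointwise. For \<open>r \<le> 1\<close> the telescoping estimate applies directly. For
  \<open>r > 1\<close> the inner sums are at most the sum over the \<open>R k\<close>, and Young's inequality splits off a small
  multiple of the left-hand side; it is absorbed, which is why the masses must be finite.\<close>

lemma nested_stretch:
  fixes c :: "'i \<Rightarrow> real"
  assumes K: "finite K" "nested K R" "\<And>k. k \<in> K \<Longrightarrow> 0 < c k"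
    and meas: "\<And>k. k \<in> K \<Longrightarrow> R k \<in> sets M" "\<And>k. k \<in> K \<Longrightarrow> E k \<in> sets M"
    and ER: "\<And>k. k \<in> K \<Longrightarrow> E k \<subseteq> R k"
    and fin: "\<And>k. k \<in> K \<Longrightarrow> emeasure M (R k) < \<infinity>"
    and le: "\<And>k. k \<in> K \<Longrightarrow> emeasure M (R k) \<le> ennreal C * emeasure M (E k)"
    and r: "0 < r" and C: "0 < C"
  shows "(\<integral>\<^sup>+x. ennreal ((\<Sum>k\<in>K. c k * indicator (R k) x) powr r) \<partial>M)
    \<le> ennreal (stretch_const C r) *
       (\<integral>\<^sup>+x. ennreal ((\<Sum>k\<in>K. c k * indicator (E k) x) powr r) \<partial>M)"
    (is "?X \<le> _ * ?Y")
proof -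
  let ?b = "\<lambda>k. c k * sum_above K R c k powr (r - 1)"
  have b: "0 \<le> ?b k" if "k \<in> K" for k using K(3)[OF that] by simp
  have X1: "?X \<le> ennreal (max 1 r) * (\<Sum>k\<in>K. ennreal (?b k) * emeasure M (R k))"
    using K meas r by (intro nn_integral_nested_sum_powr_le) auto
  have "(\<Sum>k\<in>K. ennreal (?b k) * emeasure M (R k)) \<le> (\<Sum>k\<in>K. ennreal (?b k) * (ennreal C * emeasure M (E k)))"
    using le by (intro sum_mono mult_left_mono) auto
  also have "\<dots> = ennreal C * (\<Sum>k\<in>K. ennreal (?b k) * emeasure M (E k))"
    by (simp add: sum_distrib_left mult_ac)
  also have "(\<Sum>k\<in>K. ennreal (?b k) * emeasure M (E k)) = (\<integral>\<^sup>+x. (\<Sum>k\<in>K. ennreal (?b k) * indicator (E k) x) \<partial>M)"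
    using meas by (simp add: nn_integral_sum_indicator)
  also have "\<dots> = (\<integral>\<^sup>+x. ennreal (\<Sum>k\<in>K. ?b k * indicator (E k) x) \<partial>M)"
    using ennreal_sum_indicator[of K ?b E] b by (simp only:)
  finally have "?X \<le> ennreal (max 1 r) * (ennreal C * (\<integral>\<^sup>+x. ennreal (\<Sum>k\<in>K. ?b k * indicator (E k) x) \<partial>M))"
    using X1 by (meson mult_left_mono order_trans zero_le)
  hence X2: "?X \<le> ennreal (max 1 r * C) * (\<integral>\<^sup>+x. ennreal (\<Sum>k\<in>K. ?b k * indicator (E k) x) \<partial>M)"
    using C by (simp add: ennreal_mult mult.assoc)
  show ?thesis
  proof (cases "r \<le> 1")
    case True
    have "ennreal (\<Sum>k\<in>K. ?b k * indicator (E k) x)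
        \<le> ennreal (1 / r) * ennreal ((\<Sum>k\<in>K. c k * indicator (E k) x) powr r)" for x
      using sum_above_powr_le[OF K(1,2) ER K(3) r True, where x = x] r
      by (subst ennreal_mult[symmetric]) (auto intro!: ennreal_leI simp: field_simps)
    hence "(\<integral>\<^sup>+x. ennreal (\<Sum>k\<in>K. ?b k * indicator (E k) x) \<partial>M)
        \<le> (\<integral>\<^sup>+x. ennreal (1 / r) * ennreal ((\<Sum>k\<in>K. c k * indicator (E k) x) powr r) \<partial>M)"
      by (intro nn_integral_mono)
    also have "\<dots> = ennreal (1 / r) * ?Y"
      using meas by (intro nn_integral_cmult measurable_sum_indicator_powr) auto
    finally have Ile: "(\<integral>\<^sup>+x. ennreal (\<Sum>k\<in>K. ?b k * indicator (E k) x) \<partial>M) \<le> ennreal (1 / r) * ?Y" .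
    have max: "max 1 r * C = C" using True by simp
    have "?X \<le> ennreal C * (ennreal (1 / r) * ?Y)"
      by (rule order_trans[OF X2[unfolded max] mult_left_mono[OF Ile]]) simp
    also have "\<dots> = ennreal (C / r) * ?Y"
      using C r by (simp flip: mult.assoc ennreal_mult)
    also have "\<dots> \<le> ennreal (C / r + (2 * r * C) powr r) * ?Y"
      by (intro mult_right_mono ennreal_leI) auto
    finally show ?thesis unfolding stretch_const_def .
  next
    case False
    \<comment> \<open>chosen so that the absorbed term gets the factor one half\<close>
    define e where "e = 1 / (2 * r * C)"
    have e: "0 < e" using r C by (simp add: e_def)
    have mR: "(\<lambda>x. ennreal ((\<Sum>k\<in>K. c k * indicator (R k) x) powr r)) \<in> borel_measurable M"
      and mE: "(\<lambda>x. ennreal ((\<Sum>k\<in>K. c k * indicator (E k) x) powr r)) \<in> borel_measurable M"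
      using meas by (intro measurable_sum_indicator_powr; simp)+
    have pt: "ennreal (\<Sum>k\<in>K. ?b k * indicator (E k) x)
        \<le> ennreal e * ennreal ((\<Sum>k\<in>K. c k * indicator (R k) x) powr r)
          + ennreal (e powr (1 - r)) * ennreal ((\<Sum>k\<in>K. c k * indicator (E k) x) powr r)"
      (is "_ \<le> ennreal e * ennreal (?SR powr r) + _ * ennreal (?SE powr r)") for x
    proof -
      have S: "0 \<le> ?SR" "0 \<le> ?SE" using K(3) by (auto intro!: sum_nonneg mult_nonneg_nonneg intro: less_imp_le)
      have "(\<Sum>k\<in>K. ?b k * indicator (E k) x) \<le> (\<Sum>k\<in>K. c k * indicator (E k) x * ?SR powr (r - 1))"
      proof (rule sum_mono)
        fix k assume k: "k \<in> K"
        show "?b k * indicator (E k) x \<le> c k * indicator (E k) x * ?SR powr (r - 1)"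
        proof (cases "x \<in> E k")
          case True
          hence "sum_above K R c k \<le> ?SR" using K ER k by (intro above_le_sum) auto
          moreover have "0 \<le> sum_above K R c k" using K k by (intro less_imp_le above_pos) auto
          ultimately have "sum_above K R c k powr (r - 1) \<le> ?SR powr (r - 1)"
            using False by (intro powr_mono2) auto
          thus ?thesis using K(3)[OF k] True by simp
        qed simp
      qed
      also have "\<dots> = ?SE * ?SR powr (r - 1)" by (simp add: sum_distrib_right)
      also have "\<dots> \<le> e * ?SR powr r + e powr (1 - r) * ?SE powr r"
        using S e False by (intro mult_powr_le_eps) auto
      finally show ?thesis
        using e by (simp add: ennreal_leI flip: ennreal_mult ennreal_plus)
    qed
    have "(\<integral>\<^sup>+x. ennreal (\<Sum>k\<in>K. ?b k * indicator (E k) x) \<partial>M)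
      \<le> (\<integral>\<^sup>+x. ennreal e * ennreal ((\<Sum>k\<in>K. c k * indicator (R k) x) powr r)
          + ennreal (e powr (1 - r)) * ennreal ((\<Sum>k\<in>K. c k * indicator (E k) x) powr r) \<partial>M)"
      using pt by (intro nn_integral_mono)
    also have "\<dots> = ennreal e * ?X + ennreal (e powr (1 - r)) * ?Y"
      by (subst nn_integral_add, simp_all only: nn_integral_cmult mR mE borel_measurable_times_ennreal borel_measurable_const)
    finally have Ile: "(\<integral>\<^sup>+x. ennreal (\<Sum>k\<in>K. ?b k * indicator (E k) x) \<partial>M)
      \<le> ennreal e * ?X + ennreal (e powr (1 - r)) * ?Y" .
    have max: "max 1 r * C = r * C" using False by simp
    have "?X \<le> ennreal (r * C) * (ennreal e * ?X + ennreal (e powr (1 - r)) * ?Y)"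
      by (rule order_trans[OF X2[unfolded max] mult_left_mono[OF Ile]]) simp
    also have "\<dots> = ennreal (r * C * e) * ?X + ennreal (r * C * e powr (1 - r)) * ?Y"
      using r C e by (simp add: distrib_left ennreal_mult mult.assoc)
    also have "r * C * e = 1 / 2" using r C by (simp add: e_def)
    also have "r * C * e powr (1 - r) = (2 * r * C) powr r / 2"
    proof -
      have "e powr (1 - r) = (2 * r * C) powr (r - 1)"
        using r C powr_minus_divide[of "2 * r * C" "r - 1"] by (simp add: e_def powr_divide)
      hence "(2 * r * C) * e powr (1 - r) = (2 * r * C) powr r"
        using r C powr_mult_base[of "2 * r * C" "r - 1"] by simp
      thus ?thesis by simp
    qed
    finally have ineq: "?X \<le> ennreal (1 / 2) * ?X + ennreal ((2 * r * C) powr r / 2) * ?Y" .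
    have "?X < \<infinity>"
    proof -
      have "ennreal (max 1 r) * (\<Sum>k\<in>K. ennreal (?b k) * emeasure M (R k)) < \<infinity>"
        using fin K(1) by (auto simp: ennreal_mult_less_top)
      thus ?thesis using X1 by (rule le_less_trans[rotated])
    qed
    then obtain X where X: "?X = ennreal X" "0 \<le> X"
      by (cases ?X) auto
    have "?X \<le> ennreal ((2 * r * C) powr r) * ?Y"
    proof (cases "?Y")
      case (real Y)
      define W where "W = (2 * r * C) powr r / 2"
      have nn: "0 \<le> (1 / 2 :: real)" "0 \<le> W" "0 \<le> 1 / 2 * X" "0 \<le> W * Y"
        using X real by (simp_all add: W_def)
      have "ennreal X \<le> ennreal (1 / 2) * ennreal X + ennreal W * ennreal Y"
        using ineq unfolding X(1) real(2) W_def .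
      also have "\<dots> = ennreal (1 / 2 * X + W * Y)"
        by (simp only: ennreal_plus[OF nn(3,4)] ennreal_mult[OF nn(1) X(2)] ennreal_mult[OF nn(2) real(1)])
      finally have "ennreal X \<le> ennreal (1 / 2 * X + W * Y)" .
      hence "ennreal X \<le> ennreal (1 / 2 * X + (2 * r * C) powr r / 2 * Y)"
        by (simp only: W_def)
      hence "X \<le> 1 / 2 * X + (2 * r * C) powr r / 2 * Y"
        using X real by (subst (asm) ennreal_le_iff) auto
      thus ?thesis using X real by (simp add: ennreal_leI flip: ennreal_mult)
    next
      case top
      thus ?thesis using r C by (simp add: ennreal_mult_top)
    qed
    also have "\<dots> \<le> ennreal (C / r + (2 * r * C) powr r) * ?Y"
      using r C by (intro mult_right_mono ennreal_leI) auto
    finally show ?thesis unfolding stretch_const_def .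
  qed
qed

section \<open>Cubes and shifted dyadic grids\<close>

text \<open>A cube with an arbitrary part of its boundary: closed cubes are the ones in the inequality, half-open
  ones form the grids.\<close>

definition cubelike :: "real ^ 'n \<Rightarrow> real \<Rightarrow> (real ^ 'n) set \<Rightarrow> bool" where
  "cubelike a l R \<longleftrightarrow> 0 < l \<and> box a (a + (\<chi> i. l)) \<subseteq> R \<and> R \<subseteq> cbox a (a + (\<chi> i. l))"

lemma cubelike_diff_negligible:
  assumes "cubelike a l R"
  shows "negligible (cbox a (a + (\<chi> i. l)) - R)" "negligible (R - box a (a + (\<chi> i. l)))"
  using assms negligible_frontier_interval[of a "a + (\<chi> i. l)"]
  by (auto simp: cubelike_def elim!: negligible_subset)

lemma cubelike_sets:
  assumes "cubelike a l R"
  shows "R \<in> sets lebesgue"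
proof -
  have "R = box a (a + (\<chi> i. l)) \<union> (R - box a (a + (\<chi> i. l)))"
    using assms by (auto simp: cubelike_def)
  also have "\<dots> \<in> sets lebesgue"
    using cubelike_diff_negligible(2)[OF assms] by (intro sets.Un) (auto intro: negligible_imp_sets)
  finally show ?thesis .
qed

lemma measure_cube:
  fixes a :: "real ^ 'n"
  assumes "0 < l"
  shows "measure lebesgue (cbox a (a + (\<chi> i. l))) = l ^ CARD('n)"
proof -
  have "measure lebesgue (cbox a (a + (\<chi> i. l))) = measure lborel (cbox a (a + (\<chi> i. l)))"
    by (intro measure_completion) simp
  also have "\<dots> = l ^ CARD('n)"
    using assms by (subst content_cbox_cart) (auto simp: interval_ne_empty_cart)
  finally show ?thesis .
qed

lemma cubelike_AE_eq:
  fixes a :: "real ^ 'n"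
  assumes "cubelike a l R"
  shows "AE x in lebesgue. x \<in> R \<longleftrightarrow> x \<in> cbox a (a + (\<chi> i. l))"
proof (rule AE_I')
  show "cbox a (a + (\<chi> i. l)) - R \<in> null_sets lebesgue"
    using cubelike_diff_negligible(1)[OF assms] by (simp add: negligible_iff_null_sets)
  show "{x \<in> space lebesgue. \<not> (x \<in> R \<longleftrightarrow> x \<in> cbox a (a + (\<chi> i. l)))} \<subseteq> cbox a (a + (\<chi> i. l)) - R"
    using assms by (auto simp: cubelike_def)
qed

lemma cubelike_emeasure:
  fixes a :: "real ^ 'n"
  assumes "cubelike a l R"
  shows "emeasure lebesgue R = ennreal (l ^ CARD('n))" "measure lebesgue R = l ^ CARD('n)"
proof -
  have l: "0 < l" using assms by (simp add: cubelike_def)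
  have "emeasure lebesgue R = emeasure lebesgue (cbox a (a + (\<chi> i. l)))"
    using cubelike_AE_eq[OF assms] cubelike_sets[OF assms] by (intro emeasure_eq_AE) auto
  also have "\<dots> = ennreal (measure lebesgue (cbox a (a + (\<chi> i. l))))"
    by (intro emeasure_eq_ennreal_measure) (simp add: emeasure_lborel_cbox_eq)
  finally show "emeasure lebesgue R = ennreal (l ^ CARD('n))"
    using l by (simp only: measure_cube)
  thus "measure lebesgue R = l ^ CARD('n)"
    using l by (simp add: measure_def)
qed

text \<open>The one-third trick. The grids \<open>\<int>\<close> and \<open>\<int> + 2\<^sup>d / 3\<close> have distance at least \<open>1 / 3\<close>, as 3 does
  not divide a power of 2. An interval of length at most \<open>1 / 3\<close>, open on the left, therefore cannot meet both of them.\<close>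

lemma floor_eq_or_shifted_floor_eq:
  fixes y t :: real
  assumes "0 \<le> t" "t \<le> 1 / 3"
  shows "\<lfloor>y\<rfloor> = \<lfloor>y + t\<rfloor> \<or> \<lfloor>y - 2 ^ d / 3\<rfloor> = \<lfloor>y + t - 2 ^ d / 3\<rfloor>"
proof (rule ccontr)
  let ?w = "2 ^ d / 3 :: real"
  assume "\<not> ?thesis"
  hence "\<lfloor>y\<rfloor> < \<lfloor>y + t\<rfloor>" "\<lfloor>y - ?w\<rfloor> < \<lfloor>y + t - ?w\<rfloor>"
    using assms floor_mono[of y "y + t"] floor_mono[of "y - ?w" "y + t - ?w"] by auto
  then obtain m k :: int where m: "y < m" "m \<le> y + t" and k: "y - ?w < k" "k \<le> y + t - ?w"
    by (metis floor_less_iff of_int_floor_le)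
  have "\<bar>real_of_int (3 * (m - k)) - 2 ^ d\<bar> < 1"
    using m k assms by (simp add: abs_less_iff)
  hence "\<bar>real_of_int (3 * (m - k) - 2 ^ d)\<bar> < 1" by simp
  hence "3 * (m - k) - 2 ^ d = 0" by linarith
  hence "(3::int) dvd 2 ^ d" by (metis dvd_triv_left eq_iff_diff_eq_0)
  hence "(3::nat) dvd 2 ^ d" by (metis int_dvd_int_iff of_nat_numeral of_nat_power)
  thus False using prime_dvd_power_nat[of 3 2 d] by simp
qed

text \<open>The half-open cube containing \<open>a\<close> of the grid with mesh \<open>\<delta> 2\<^sup>j\<close> and origin \<open>\<theta>\<close>, described by the
  integer parts of the scaled coordinates, which makes nestedness a statement about integer division.\<close>

definition cell :: "real \<Rightarrow> real ^ 'n \<Rightarrow> nat \<Rightarrow> real ^ 'n \<Rightarrow> (real ^ 'n) set" where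
  "cell \<delta> \<theta> j a = {x. \<forall>i. \<lfloor>(x $ i - \<theta> $ i) / (\<delta> * 2 ^ j)\<rfloor> = \<lfloor>(a $ i - \<theta> $ i) / (\<delta> * 2 ^ j)\<rfloor>}"

lemma cell_mono:
  assumes "0 < \<delta>" "j \<le> j'" "y \<in> cell \<delta> \<theta> j x"
  shows "y \<in> cell \<delta> \<theta> j' x"
proof -
  have coarse: "\<lfloor>z / (\<delta> * 2 ^ j')\<rfloor> = \<lfloor>z / (\<delta> * 2 ^ j)\<rfloor> div 2 ^ (j' - j)" for z :: real
  proof -
    have "z / (\<delta> * 2 ^ j') = (z / (\<delta> * 2 ^ j)) / real_of_int (2 ^ (j' - j))"
      using assms by (simp add: field_simps flip: power_add)
    thus ?thesis by (simp only: floor_divide_real_eq_div zero_le_power zero_le_numeral)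
  qed
  show ?thesis using assms(3) unfolding cell_def coarse by simp
qed

lemma cells_nested:
  assumes "0 < \<delta>"
  shows "nested K (\<lambda>k. cell \<delta> \<theta> (j k) (a k))"
proof -
  have sub: "cell \<delta> \<theta> i x \<subseteq> cell \<delta> \<theta> i' y"
    if "z \<in> cell \<delta> \<theta> i x" "z \<in> cell \<delta> \<theta> i' y" "i \<le> i'" for i i' x y z
  proof
    fix w assume "w \<in> cell \<delta> \<theta> i x"
    hence "w \<in> cell \<delta> \<theta> i z" using that(1) by (simp add: cell_def)
    hence "w \<in> cell \<delta> \<theta> i' z" using cell_mono[OF assms that(3)] by blast
    thus "w \<in> cell \<delta> \<theta> i' y" using that(2) by (simp add: cell_def)
  qed
  show ?thesis unfolding nested_def
    using sub by (metis disjoint_iff nle_le)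
qed

lemma cell_cubelike:
  fixes \<theta> a :: "real ^ 'n" and j :: nat
  assumes "0 < \<delta>"
  defines "b \<equiv> (\<chi> i. \<theta> $ i + \<delta> * 2 ^ j * of_int \<lfloor>(a $ i - \<theta> $ i) / (\<delta> * 2 ^ j)\<rfloor>)"
  shows "cubelike b (\<delta> * 2 ^ j) (cell \<delta> \<theta> j a)"
proof -
  have h: "0 < \<delta> * 2 ^ j" using assms by simp
  have eq: "cell \<delta> \<theta> j a = {x. \<forall>i. b $ i \<le> x $ i \<and> x $ i < b $ i + \<delta> * 2 ^ j}"
    using h unfolding cell_def b_def by (simp add: floor_eq_iff field_simps)
  show ?thesis unfolding cubelike_def eq
    using h by (auto simp: mem_box_cart less_imp_le)
qed

text \<open>The corner inequalities are kept next to the inclusion since they are what the doubling argument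
  needs.\<close>

lemma cube_subset_cell:
  fixes \<theta> a :: "real ^ 'n"
  assumes "0 < \<delta>" "0 < l"
    and same: "\<And>i. \<lfloor>(a $ i + l - \<theta> $ i) / (\<delta> * 2 ^ j)\<rfloor> = \<lfloor>(a $ i - \<theta> $ i) / (\<delta> * 2 ^ j)\<rfloor>"
  shows "\<exists>b. cubelike b (\<delta> * 2 ^ j) (cell \<delta> \<theta> j a) \<and> (\<forall>i. b $ i \<le> a $ i \<and> a $ i + l \<le> b $ i + \<delta> * 2 ^ j)
    \<and> cbox a (a + (\<chi> i. l)) \<subseteq> cell \<delta> \<theta> j a"
proof -
  define F where "F i = \<lfloor>(a $ i - \<theta> $ i) / (\<delta> * 2 ^ j)\<rfloor>" for i
  define b where "b = (\<chi> i. \<theta> $ i + \<delta> * 2 ^ j * of_int (F i))"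
  have h: "0 < \<delta> * 2 ^ j" using assms by simp
  have 1: "b $ i \<le> a $ i" for i
  proof -
    have "of_int (F i) * (\<delta> * 2 ^ j) \<le> a $ i - \<theta> $ i"
      using of_int_floor_le[of "(a $ i - \<theta> $ i) / (\<delta> * 2 ^ j)"]
      unfolding F_def[symmetric] pos_le_divide_eq[OF h] .
    thus ?thesis by (simp add: b_def mult.commute)
  qed
  have 2: "a $ i + l \<le> b $ i + \<delta> * 2 ^ j" for i
  proof -
    have "(a $ i + l - \<theta> $ i) / (\<delta> * 2 ^ j) < of_int (F i) + 1"
      unfolding F_def same[symmetric] by linarith
    hence "a $ i + l - \<theta> $ i < (of_int (F i) + 1) * (\<delta> * 2 ^ j)"
      unfolding pos_divide_less_eq[OF h] .
    thus ?thesis by (simp add: b_def algebra_simps)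
  qed
  have "cbox a (a + (\<chi> i. l)) \<subseteq> cell \<delta> \<theta> j a"
  proof
    fix x assume x: "x \<in> cbox a (a + (\<chi> i. l))"
    have "\<lfloor>(x $ i - \<theta> $ i) / (\<delta> * 2 ^ j)\<rfloor> = F i" for i
    proof (rule antisym)
      have xi: "a $ i \<le> x $ i" "x $ i \<le> a $ i + l" using x by (auto simp: mem_box_cart)
      show "\<lfloor>(x $ i - \<theta> $ i) / (\<delta> * 2 ^ j)\<rfloor> \<le> F i"
        unfolding F_def same[symmetric] using xi h by (intro floor_mono divide_right_mono) auto
      show "F i \<le> \<lfloor>(x $ i - \<theta> $ i) / (\<delta> * 2 ^ j)\<rfloor>"
        unfolding F_def using xi h by (intro floor_mono divide_right_mono) auto
    qed
    thus "x \<in> cell \<delta> \<theta> j a" by (simp add: cell_def F_def)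
  qed
  moreover have "cubelike b (\<delta> * 2 ^ j) (cell \<delta> \<theta> j a)"
    unfolding b_def F_def by (rule cell_cubelike[OF assms(1)])
  ultimately show ?thesis using 1 2 by blast
qed

lemma exists_dyadic_between:
  fixes \<delta> l :: real
  assumes "0 < \<delta>" "\<delta> \<le> l"
  shows "\<exists>j. 3 * l \<le> \<delta> * 2 ^ j \<and> \<delta> * 2 ^ j \<le> 6 * l"
proof -
  obtain N where N: "3 * l / \<delta> < 2 ^ N"
    using real_arch_pow[of 2 "3 * l / \<delta>"] by auto
  define j where "j = (LEAST j. 3 * l \<le> \<delta> * 2 ^ j)"
  have ex: "3 * l \<le> \<delta> * 2 ^ N" using N assms by (simp add: field_simps)
  have j: "3 * l \<le> \<delta> * 2 ^ j" unfolding j_def using ex by (rule LeastI)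
  obtain i where i: "j = Suc i" using j assms by (cases j) auto
  have "\<not> 3 * l \<le> \<delta> * 2 ^ i"
    using not_less_Least[of i "\<lambda>j. 3 * l \<le> \<delta> * 2 ^ j"] i j_def by simp
  thus ?thesis using j i by (intro exI[of _ j]) auto
qed

text \<open>Since \<open>K\<close> is finite there are a smallest side length \<open>\<delta>\<close> and a largest scale \<open>J\<close>. Shifting
  coordinates by \<open>\<delta> 2\<^sup>J / 3\<close> moves the grid of every scale \<open>j \<le> J\<close> by \<open>2\<^sup>J\<^sup>-\<^sup>j / 3\<close> of its mesh, and
  the one-third trick works at all scales with one shift. The label \<open>T k\<close> is the set of coordinates
  in which the unshifted grid cuts the \<open>k\<close>-th cube.\<close>

lemma cubes_in_shifted_grids:
  fixes a :: "'i \<Rightarrow> real ^ 'n"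
  assumes K: "finite K" and l: "\<And>k. k \<in> K \<Longrightarrow> 0 < l k"
  shows "\<exists>(T :: 'i \<Rightarrow> 'n set) b h R.
    (\<forall>S. nested {k \<in> K. T k = S} R) \<and>
    (\<forall>k\<in>K. cubelike (b k) (h k) (R k) \<and> cbox (a k) (a k + (\<chi> i. l k)) \<subseteq> R k \<and> h k \<le> 6 * l k
      \<and> (\<forall>i. b k $ i \<le> a k $ i \<and> a k $ i + l k \<le> b k $ i + h k))"
proof (cases "K = {}")
  case True
  thus ?thesis by (simp add: nested_def)
next
  case ne: False
  define \<delta> where "\<delta> = Min (l ` K)"
  have \<delta>: "0 < \<delta>" using K ne l by (simp add: \<delta>_def)
  have \<delta>l: "\<delta> \<le> l k" if "k \<in> K" for k using K that by (simp add: \<delta>_def)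
  have "\<forall>k\<in>K. \<exists>j. 3 * l k \<le> \<delta> * 2 ^ j \<and> \<delta> * 2 ^ j \<le> 6 * l k"
    using exists_dyadic_between[OF \<delta> \<delta>l] by blast
  then obtain j where j: "\<And>k. k \<in> K \<Longrightarrow> 3 * l k \<le> \<delta> * 2 ^ j k" "\<And>k. k \<in> K \<Longrightarrow> \<delta> * 2 ^ j k \<le> 6 * l k"
    by metis
  define J where "J = Max (j ` K)"
  have J: "j k \<le> J" if "k \<in> K" for k using K that by (simp add: J_def)
  define \<theta> :: "'n set \<Rightarrow> real ^ 'n" where "\<theta> S = (\<chi> i. if i \<in> S then \<delta> * 2 ^ J / 3 else 0)" for S
  define T where "T k = {i. \<lfloor>a k $ i / (\<delta> * 2 ^ j k)\<rfloor> \<noteq> \<lfloor>(a k $ i + l k) / (\<delta> * 2 ^ j k)\<rfloor>}" for k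
  define R where "R k = cell \<delta> (\<theta> (T k)) (j k) (a k)" for k
  have same: "\<lfloor>(a k $ i + l k - \<theta> (T k) $ i) / (\<delta> * 2 ^ j k)\<rfloor> = \<lfloor>(a k $ i - \<theta> (T k) $ i) / (\<delta> * 2 ^ j k)\<rfloor>"
    if k: "k \<in> K" for k i
  proof (cases "i \<in> T k")
    case True
    let ?h = "\<delta> * 2 ^ j k"
    have h: "0 < ?h" using \<delta> by simp
    have w: "\<delta> * 2 ^ J / 3 / ?h = 2 ^ (J - j k) / 3"
      using \<delta> J[OF k] by (simp add: field_simps flip: power_add)
    have "\<lfloor>a k $ i / ?h\<rfloor> = \<lfloor>a k $ i / ?h + l k / ?h\<rfloor> \<or>
      \<lfloor>a k $ i / ?h - 2 ^ (J - j k) / 3\<rfloor> = \<lfloor>a k $ i / ?h + l k / ?h - 2 ^ (J - j k) / 3\<rfloor>"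
      using h l[OF k] j(1)[OF k] by (intro floor_eq_or_shifted_floor_eq) (auto simp: field_simps)
    moreover have "\<lfloor>a k $ i / ?h\<rfloor> \<noteq> \<lfloor>a k $ i / ?h + l k / ?h\<rfloor>"
      using True by (simp add: T_def add_divide_distrib)
    moreover have th: "\<theta> (T k) $ i = \<delta> * 2 ^ J / 3" using True by (simp add: \<theta>_def)
    ultimately show ?thesis
      unfolding th diff_divide_distrib add_divide_distrib w by auto
  next
    case False
    thus ?thesis by (simp add: \<theta>_def T_def)
  qed
  have "\<forall>k\<in>K. \<exists>b. cubelike b (\<delta> * 2 ^ j k) (R k)
      \<and> (\<forall>i. b $ i \<le> a k $ i \<and> a k $ i + l k \<le> b $ i + \<delta> * 2 ^ j k)
      \<and> cbox (a k) (a k + (\<chi> i. l k)) \<subseteq> R k"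
    unfolding R_def using \<delta> l same by (intro ballI cube_subset_cell) auto
  then obtain b where b: "\<And>k. k \<in> K \<Longrightarrow> cubelike (b k) (\<delta> * 2 ^ j k) (R k)
      \<and> (\<forall>i. b k $ i \<le> a k $ i \<and> a k $ i + l k \<le> b k $ i + \<delta> * 2 ^ j k)
      \<and> cbox (a k) (a k + (\<chi> i. l k)) \<subseteq> R k"
    by metis
  have nest: "nested {k \<in> K. T k = S} R" for S
  proof -
    have "nested {k \<in> K. T k = S} (\<lambda>k. cell \<delta> (\<theta> S) (j k) (a k))"
      using \<delta> by (rule cells_nested)
    thus ?thesis unfolding nested_def R_def by simp
  qed
  show ?thesis
    by (rule exI[of _ T], rule exI[of _ b], rule exI[of _ "\<lambda>k. \<delta> * 2 ^ j k"], rule exI[of _ R])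
      (use nest b j in auto)
qed

section \<open>Weights satisfying a reverse Hoelder inequality\<close>

text \<open>The weight is real-valued and positive everywhere here; changing it on a null set achieves this.
  The witness \<open>m\<close> in the last assumption is the mean of \<open>v\<close> over the cube.\<close>

locale reverse_holder_weight =
  fixes v :: "real ^ 'n \<Rightarrow> real" and s A :: real
  assumes v_meas: "v \<in> borel_measurable lebesgue"
    and v_pos: "0 < v x"
    and s_gt1: "1 < s" and A_pos: "0 < A"
    and cube_bound: "0 < l \<Longrightarrow> \<exists>m>0.
      (\<integral>\<^sup>+x\<in>cbox a (a + (\<chi> i. l)). ennreal (v x) \<partial>lebesgue) = ennreal (m * l ^ CARD('n)) \<and>
      (\<integral>\<^sup>+x\<in>cbox a (a + (\<chi> i. l)). ennreal (v x powr s) \<partial>lebesgue) \<le> ennreal (A * m powr s * l ^ CARD('n))"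
begin

definition V :: "(real ^ 'n) measure" where
  "V = density lebesgue (\<lambda>x. ennreal (v x))"

definition U :: "(real ^ 'n) measure" where
  "U = density lebesgue (\<lambda>x. ennreal (v x powr s))"

lemma v_meas' [measurable]: "v \<in> borel_measurable lebesgue"
  by (rule v_meas)

lemma sets_VU [simp]: "sets V = sets lebesgue" "sets U = sets lebesgue"
  by (simp_all add: V_def U_def)

lemma emeasure_VU:
  assumes "S \<in> sets lebesgue"
  shows "emeasure V S = (\<integral>\<^sup>+x\<in>S. ennreal (v x) \<partial>lebesgue)"
    "emeasure U S = (\<integral>\<^sup>+x\<in>S. ennreal (v x powr s) \<partial>lebesgue)"
  using assms by (simp_all add: V_def U_def emeasure_density)

lemma V_le_measure:
  assumes "S \<in> lmeasurable" "\<And>x. x \<in> S \<Longrightarrow> v x \<le> t" "0 \<le> t"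
  shows "emeasure V S \<le> ennreal (t * measure lebesgue S)"
proof -
  have S: "S \<in> sets lebesgue" using assms(1) by auto
  have "emeasure V S \<le> (\<integral>\<^sup>+x\<in>S. ennreal t \<partial>lebesgue)"
    unfolding emeasure_VU(1)[OF S] using assms(2)
    by (intro nn_integral_mono) (auto simp: indicator_def intro!: ennreal_leI)
  also have "\<dots> = ennreal t * emeasure lebesgue S"
    using S by (rule nn_integral_cmult_indicator)
  also have "\<dots> = ennreal (t * measure lebesgue S)"
    using assms by (simp add: emeasure_eq_measure2 ennreal_mult)
  finally show ?thesis .
qed

text \<open>Where \<open>v\<close> is large, \<open>v\<^sup>s\<close> dominates \<open>v\<close>.\<close>

lemma V_le_U:
  assumes "S \<in> sets lebesgue" "\<And>x. x \<in> S \<Longrightarrow> t \<le> v x" "0 < t"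
  shows "ennreal (t powr (s - 1)) * emeasure V S \<le> emeasure U S"
proof -
  have [measurable]: "S \<in> sets lebesgue" by fact
  have "ennreal (t powr (s - 1)) * emeasure V S
      = (\<integral>\<^sup>+x. ennreal (t powr (s - 1)) * (ennreal (v x) * indicator S x) \<partial>lebesgue)"
    unfolding emeasure_VU(1)[OF assms(1)]
    by (intro nn_integral_cmult[symmetric]) measurable
  also have "\<dots> \<le> emeasure U S"
    unfolding emeasure_VU(2)[OF assms(1)]
  proof (intro nn_integral_mono)
    fix x
    show "ennreal (t powr (s - 1)) * (ennreal (v x) * indicator S x) \<le> ennreal (v x powr s) * indicator S x"
    proof (cases "x \<in> S")
      case True
      have "t powr (s - 1) * v x \<le> v x powr (s - 1) * v x"
        using assms True v_pos[of x] s_gt1 by (intro mult_right_mono powr_mono2) auto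
      also have "\<dots> = v x powr s"
        using v_pos[of x] powr_mult_base[of "v x" "s - 1"] by (simp add: mult.commute)
      finally show ?thesis using True v_pos[of x]
        by (simp add: ennreal_leI flip: ennreal_mult)
    qed simp
  qed
  finally show ?thesis .
qed

text \<open>The mean of \<open>v\<close> over \<open>R\<close> is \<open>m\<close>, and the reverse Hoelder inequality holds on \<open>R\<close>.\<close>

definition rh_mean :: "(real ^ 'n) set \<Rightarrow> real \<Rightarrow> bool" where
  "rh_mean R m \<longleftrightarrow> R \<in> lmeasurable \<and> 0 < m \<and>
     emeasure V R = ennreal (m * measure lebesgue R) \<and>
     emeasure U R \<le> ennreal (A * m powr s * measure lebesgue R)"

lemma cubelike_rh_mean:
  assumes "cubelike a l R"
  shows "\<exists>m. rh_mean R m"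
proof -
  let ?Q = "cbox a (a + (\<chi> i. l))"
  have l: "0 < l" using assms by (simp add: cubelike_def)
  have R: "R \<in> sets lebesgue" using assms by (rule cubelike_sets)
  have ind: "AE x in lebesgue. indicator R x = (indicator ?Q x :: ennreal)"
    using cubelike_AE_eq[OF assms] by eventually_elim (simp add: indicator_def)
  have "emeasure V R = (\<integral>\<^sup>+x\<in>?Q. ennreal (v x) \<partial>lebesgue)"
    unfolding emeasure_VU[OF R] using ind by (intro nn_integral_cong_AE) auto
  moreover have "emeasure U R = (\<integral>\<^sup>+x\<in>?Q. ennreal (v x powr s) \<partial>lebesgue)"
    unfolding emeasure_VU[OF R] using ind by (intro nn_integral_cong_AE) auto
  moreover have "R \<in> lmeasurable"
    using R cubelike_emeasure(1)[OF assms] by (simp add: fmeasurable_def)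
  ultimately show ?thesis
    using cube_bound[OF l, of a] cubelike_emeasure(2)[OF assms] unfolding rh_mean_def by auto
qed

lemma rh_mean_U_finite: "rh_mean R m \<Longrightarrow> emeasure U R < \<infinity>"
  unfolding rh_mean_def by (auto intro: le_less_trans)

text \<open>This multiple of the mean is so high that only a quarter of the mass of \<open>v\<close> lies above it.\<close>

definition tail_level :: real where "tail_level = max 1 ((4 * A) powr (1 / (s - 1)))"

lemma tail_level_bounds: "1 \<le> tail_level" "4 * A \<le> tail_level powr (s - 1)"
proof -
  show "1 \<le> tail_level" by (simp add: tail_level_def)
  have "4 * A = ((4 * A) powr (1 / (s - 1))) powr (s - 1)"
    using A_pos s_gt1 by (simp add: powr_powr)
  also have "\<dots> \<le> tail_level powr (s - 1)"
    using s_gt1 by (intro powr_mono2) (auto simp: tail_level_def)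
  finally show "4 * A \<le> tail_level powr (s - 1)" .
qed

lemma level_set_sets:
  assumes "R \<in> sets lebesgue"
  shows "{x \<in> R. v x \<le> t} \<in> sets lebesgue" "{x \<in> R. t < v x} \<in> sets lebesgue"
proof -
  have eq: "{x \<in> R. P x} = R \<inter> {x \<in> space lebesgue. P x}" for P by auto
  have "{x \<in> space lebesgue. v x \<le> t} \<in> sets lebesgue" "{x \<in> space lebesgue. t < v x} \<in> sets lebesgue"
    by measurable
  thus "{x \<in> R. v x \<le> t} \<in> sets lebesgue" "{x \<in> R. t < v x} \<in> sets lebesgue"
    unfolding eq by (auto intro: sets.Int[OF assms])
qed

text \<open>A Chebyshev argument: above the level \<open>t = tail_level * m\<close> one has \<open>v \<le> t\<^sup>1\<^sup>-\<^sup>s v\<^sup>s\<close>, and the reverse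
  Hoelder inequality bounds the integral of \<open>v\<^sup>s\<close>.\<close>

lemma V_tail:
  assumes "rh_mean R m"
  shows "emeasure V {x \<in> R. tail_level * m < v x} \<le> ennreal (m * measure lebesgue R / 4)"
proof -
  let ?H = "{x \<in> R. tail_level * m < v x}" and ?L = "measure lebesgue R"
  have R: "R \<in> sets lebesgue" and m: "0 < m" using assms by (auto simp: rh_mean_def)
  have H: "?H \<in> sets lebesgue" using R by (rule level_set_sets)
  have Mm: "0 < tail_level * m" using tail_level_bounds(1) m by simp
  have "ennreal ((tail_level * m) powr (s - 1)) * emeasure V ?H \<le> emeasure U ?H"
    using H Mm by (intro V_le_U) auto
  also have "\<dots> \<le> emeasure U R" using R by (intro emeasure_mono) auto
  also have "\<dots> \<le> ennreal (A * m powr s * ?L)" using assms by (simp add: rh_mean_def)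
  also have "\<dots> \<le> ennreal ((tail_level * m) powr (s - 1) * (m * ?L / 4))"
  proof (rule ennreal_leI)
    have "A * m powr s * ?L = 4 * A * (m powr (s - 1) * m * ?L / 4)"
      using m powr_mult_base[of m "s - 1"] by (simp add: mult_ac)
    also have "\<dots> \<le> tail_level powr (s - 1) * (m powr (s - 1) * m * ?L / 4)"
      using tail_level_bounds m by (intro mult_right_mono) auto
    also have "\<dots> = (tail_level * m) powr (s - 1) * (m * ?L / 4)"
      using tail_level_bounds m by (simp add: powr_mult)
    finally show "A * m powr s * ?L \<le> (tail_level * m) powr (s - 1) * (m * ?L / 4)" .
  qed
  also have "\<dots> = ennreal ((tail_level * m) powr (s - 1)) * ennreal (m * ?L / 4)"
    using m by (intro ennreal_mult) auto
  finally have le: "ennreal ((tail_level * m) powr (s - 1)) * emeasure V ?H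
    \<le> ennreal ((tail_level * m) powr (s - 1)) * ennreal (m * ?L / 4)" .
  have "ennreal ((tail_level * m) powr (s - 1)) \<noteq> 0" using tail_level_bounds(1) m by simp
  thus ?thesis
    by (rule ennreal_mult_le_mult_iff[THEN iffD1, OF _ ennreal_neq_top le])
qed

lemma V_half:
  assumes R: "rh_mean R m" and P: "P \<subseteq> R" "P \<in> sets lebesgue"
    and le: "emeasure V (R - P) \<le> ennreal (m * measure lebesgue R / 2)"
  shows "ennreal (m * measure lebesgue R / 2) \<le> emeasure V P"
proof -
  let ?L = "m * measure lebesgue R"
  have Rs: "R \<in> sets lebesgue" "0 < m" "emeasure V R = ennreal ?L" using R by (auto simp: rh_mean_def)
  have L: "0 \<le> ?L" using Rs by simp
  have "ennreal (?L / 2) + ennreal (?L / 2) = emeasure V R"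
    using L Rs by (simp flip: ennreal_plus)
  also have "\<dots> = emeasure V (R - P) + emeasure V P"
    using P Rs by (subst plus_emeasure) (auto simp: Un_absorb2)
  also have "\<dots> \<le> ennreal (?L / 2) + emeasure V P"
    using le by (intro add_right_mono)
  finally show ?thesis
    by (simp add: ennreal_add_left_cancel_le)
qed

text \<open>On \<open>R - P\<close> the weight is either above the tail level, where it has a quarter of the mass, or it is
  bounded and \<open>R - P\<close> is too small to carry more than another quarter.\<close>

lemma V_le_of_small_diff:
  assumes R: "rh_mean R m" and P: "P \<subseteq> R" "P \<in> sets lebesgue"
    and le: "measure lebesgue (R - P) \<le> measure lebesgue R / (4 * tail_level)"
  shows "emeasure V R \<le> ennreal 2 * emeasure V P"
proof -
  let ?H = "{x \<in> R. tail_level * m < v x}" and ?G = "{x \<in> R - P. v x \<le> tail_level * m}" and ?L = "measure lebesgue R"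
  have Rs: "R \<in> lmeasurable" "0 < m" "emeasure V R = ennreal (m * ?L)" using R by (auto simp: rh_mean_def)
  have RP: "R - P \<in> lmeasurable" using Rs(1) P(2) by (intro fmeasurable_Diff) auto
  have sets: "?H \<in> sets lebesgue" "?G \<in> sets lebesgue"
    by (rule level_set_sets, use Rs(1) in blast, rule level_set_sets, use RP in blast)
  have "?G \<in> lmeasurable"
    by (rule fmeasurableI2[OF RP _ sets(2)]) auto
  hence "emeasure V ?G \<le> ennreal (tail_level * m * measure lebesgue ?G)"
    by (rule V_le_measure) (use tail_level_bounds(1) Rs(2) in auto)
  also have "\<dots> \<le> ennreal (tail_level * m * (?L / (4 * tail_level)))"
  proof (intro ennreal_leI mult_left_mono)
    have "measure lebesgue ?G \<le> measure lebesgue (R - P)"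
      by (rule measure_mono_fmeasurable[OF _ sets(2) RP]) auto
    thus "measure lebesgue ?G \<le> ?L / (4 * tail_level)" using le by (rule order_trans)
  qed (use tail_level_bounds Rs in auto)
  also have "tail_level * m * (?L / (4 * tail_level)) = m * ?L / 4" using tail_level_bounds(1) by simp
  finally have G: "emeasure V ?G \<le> ennreal (m * ?L / 4)" .
  have "R - P \<subseteq> ?H \<union> ?G" by auto
  hence "emeasure V (R - P) \<le> emeasure V (?H \<union> ?G)"
    using sets by (intro emeasure_mono sets.Un) (simp_all only: sets_VU)
  also have "\<dots> \<le> emeasure V ?H + emeasure V ?G"
    using sets by (intro emeasure_subadditive) (simp_all only: sets_VU)
  also have "\<dots> \<le> ennreal (m * ?L / 4) + ennreal (m * ?L / 4)"
    using G V_tail[OF R] by (intro add_mono)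
  also have "\<dots> = ennreal (m * ?L / 2)"
    using Rs by (simp flip: ennreal_plus)
  finally have half: "ennreal (m * ?L / 2) \<le> emeasure V P"
    by (rule V_half[OF R P])
  have "emeasure V R = ennreal (2 * (m * ?L / 2))"
    using Rs by simp
  also have "\<dots> = ennreal 2 * ennreal (m * ?L / 2)"
    using Rs by (intro ennreal_mult) auto
  also have "\<dots> \<le> ennreal 2 * emeasure V P"
    using half by (intro mult_left_mono) auto
  finally show ?thesis .
qed

text \<open>The set \<open>{m / 4 < v \<le> tail_level * m}\<close> carries at least half of the mass of \<open>v\<close>, because a quarter is
  lost on either side. On it \<open>v\<^sup>s\<close> is at least \<open>(m / 4)\<^sup>s\<^sup>-\<^sup>1 v\<close>, and the reverse Hoelder inequality
  says that \<open>m\<^sup>s |R|\<close> is up to a constant the largest possible value of the integral of \<open>v\<^sup>s\<close> over \<open>R\<close>.\<close>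

lemma U_le_of_bounded_part:
  assumes R: "rh_mean R m"
  shows "emeasure U R \<le> ennreal (4 powr s * A) * emeasure U {x \<in> R. v x \<le> tail_level * m}"
proof -
  let ?E = "{x \<in> R. v x \<le> tail_level * m}" and ?L = "measure lebesgue R"
  let ?P = "{x \<in> ?E. m / 4 < v x}" and ?S = "{x \<in> R. v x \<le> m / 4}" and ?H = "{x \<in> R. tail_level * m < v x}"
  have Rs: "R \<in> lmeasurable" "R \<in> sets lebesgue" "0 < m" "emeasure U R \<le> ennreal (A * m powr s * ?L)"
    using R unfolding rh_mean_def by (blast intro: fmeasurableD)+
  have E_sets: "?E \<in> sets lebesgue" by (rule level_set_sets[OF Rs(2)])
  have sets: "?E \<in> sets lebesgue" "?P \<in> sets lebesgue" "?S \<in> sets lebesgue" "?H \<in> sets lebesgue"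
    by (rule E_sets level_set_sets[OF E_sets] level_set_sets[OF Rs(2)])+
  have S: "?S \<in> lmeasurable" by (rule fmeasurableI2[OF Rs(1) _ sets(3)]) auto
  hence "emeasure V ?S \<le> ennreal (m / 4 * measure lebesgue ?S)"
    by (rule V_le_measure) (use Rs(3) in auto)
  also have "\<dots> \<le> ennreal (m / 4 * ?L)"
  proof (intro ennreal_leI mult_left_mono)
    have "?S \<subseteq> R" by auto
    thus "measure lebesgue ?S \<le> ?L" using sets(3) Rs(1) by (rule measure_mono_fmeasurable)
  qed (use Rs in simp)
  finally have S_le: "emeasure V ?S \<le> ennreal (m * ?L / 4)" by simp
  have "R - ?P \<subseteq> ?H \<union> ?S" by auto
  hence "emeasure V (R - ?P) \<le> emeasure V (?H \<union> ?S)"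
    using sets by (intro emeasure_mono sets.Un) (simp_all only: sets_VU)
  also have "\<dots> \<le> emeasure V ?H + emeasure V ?S"
    using sets by (intro emeasure_subadditive) (simp_all only: sets_VU)
  also have "\<dots> \<le> ennreal (m * ?L / 4) + ennreal (m * ?L / 4)"
    using S_le V_tail[OF R] by (intro add_mono)
  also have "\<dots> = ennreal (m * ?L / 2)"
    using Rs by (simp flip: ennreal_plus)
  finally have half: "ennreal (m * ?L / 2) \<le> emeasure V ?P"
    by (rule V_half[OF R _ sets(2), rotated]) auto
  have "ennreal ((m / 4) powr (s - 1)) * ennreal (m * ?L / 2) \<le> ennreal ((m / 4) powr (s - 1)) * emeasure V ?P"
    using half by (intro mult_left_mono) auto
  also have "\<dots> \<le> emeasure U ?P"
    by (rule V_le_U[OF sets(2)]) (use Rs(3) in auto)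
  also have "\<dots> \<le> emeasure U ?E"
    by (rule emeasure_mono) (auto simp only: sets_VU sets(1))
  finally have E: "ennreal ((m / 4) powr (s - 1)) * ennreal (m * ?L / 2) \<le> emeasure U ?E" .
  have "emeasure U R \<le> ennreal (A * m powr s * ?L)" by (rule Rs)
  also have "\<dots> \<le> ennreal (4 powr s * A * ((m / 4) powr (s - 1) * (m * ?L / 2)))"
  proof (rule ennreal_leI)
    have "4 powr s * A * ((m / 4) powr (s - 1) * (m * ?L / 2))
        = 4 powr s / 4 powr (s - 1) * A * (m powr (s - 1) * m) * ?L / 2"
      using Rs by (simp add: powr_divide)
    also have "4 powr s / 4 powr (s - 1) = (4::real)" by (simp flip: powr_diff)
    also have "m powr (s - 1) * m = m powr s"
      using Rs powr_mult_base[of m "s - 1"] by (simp add: mult.commute)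
    also have "4 * A * m powr s * ?L / 2 = 2 * (A * m powr s * ?L)" by simp
    finally have eq: "4 powr s * A * ((m / 4) powr (s - 1) * (m * ?L / 2)) = 2 * (A * m powr s * ?L)" .
    have "0 \<le> A * m powr s * ?L" using A_pos by simp
    thus "A * m powr s * ?L \<le> 4 powr s * A * ((m / 4) powr (s - 1) * (m * ?L / 2))"
      unfolding eq by linarith
  qed
  also have "\<dots> = ennreal (4 powr s * A) * (ennreal ((m / 4) powr (s - 1)) * ennreal (m * ?L / 2))"
  proof -
    have "ennreal ((m / 4) powr (s - 1) * (m * ?L / 2)) = ennreal ((m / 4) powr (s - 1)) * ennreal (m * ?L / 2)"
      using Rs(3) by (intro ennreal_mult) auto
    moreover have "ennreal (4 powr s * A * ((m / 4) powr (s - 1) * (m * ?L / 2)))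
        = ennreal (4 powr s * A) * ennreal ((m / 4) powr (s - 1) * (m * ?L / 2))"
      using A_pos Rs(3) by (intro ennreal_mult) auto
    ultimately show ?thesis by (simp only:)
  qed
  also have "\<dots> \<le> ennreal (4 powr s * A) * emeasure U ?E"
    using E by (intro mult_left_mono) auto
  finally show ?thesis .
qed

lemma V_cube_le_twice:
  fixes a b :: "real ^ 'n" and l h :: real
  assumes l: "0 < l" and corner: "\<And>i. b $ i \<le> a $ i" "\<And>i. a $ i + l \<le> b $ i + h"
    and close: "CARD('n) * (h - l) / h \<le> 1 / (4 * tail_level)"
  shows "emeasure V (cbox b (b + (\<chi> i. h))) \<le> ennreal 2 * emeasure V (cbox a (a + (\<chi> i. l)))"
    (is "emeasure V ?R \<le> _ * emeasure V ?P")
proof -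
  have "a $ undefined + l \<le> a $ undefined + h"
    using corner[of undefined] by linarith
  hence h: "0 < h" "l \<le> h" using l by auto
  have sub: "?P \<subseteq> ?R"
  proof
    fix x assume x: "x \<in> ?P"
    have "b $ i \<le> x $ i \<and> x $ i \<le> b $ i + h" for i
      using x corner[of i] by (simp add: mem_box_cart) (smt (verit))
    thus "x \<in> ?R" by (simp add: mem_box_cart)
  qed
  have "cubelike b h ?R" using h by (simp add: cubelike_def box_subset_cbox)
  then obtain m where m: "rh_mean ?R m" using cubelike_rh_mean by blast
  have "1 + real CARD('n) * - ((h - l) / h) \<le> (1 + - ((h - l) / h)) ^ CARD('n)"
    using h l by (intro Bernoulli_inequality) (auto simp: field_simps)
  also have "1 + - ((h - l) / h) = l / h" using h by (simp add: field_simps)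
  finally have "1 - 1 / (4 * tail_level) \<le> (l / h) ^ CARD('n)" using close by simp
  hence "h ^ CARD('n) * (1 - 1 / (4 * tail_level)) \<le> h ^ CARD('n) * (l / h) ^ CARD('n)"
    using h by (intro mult_left_mono) auto
  hence vol: "h ^ CARD('n) - l ^ CARD('n) \<le> h ^ CARD('n) / (4 * tail_level)"
    using h by (simp add: power_divide algebra_simps)
  have "measure lebesgue (?R - ?P) = measure lebesgue ?R - measure lebesgue ?P"
    using sub by (intro measurable_measure_Diff) auto
  also have "\<dots> \<le> measure lebesgue ?R / (4 * tail_level)"
    using vol by (simp only: measure_cube[OF l] measure_cube[OF h(1)])
  finally show ?thesis
    using m sub by (intro V_le_of_small_diff) auto
qed

text \<open>One factor 2 for each step of an interpolation between a cube and its enlargement.\<close>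

definition doubling_const :: real where
  "doubling_const = 2 ^ nat \<lceil>20 * real CARD('n) * tail_level\<rceil>"

text \<open>Interpolate linearly between the two cubes in so many steps that consecutive cubes are
  close enough for \<open>V_cube_le_twice\<close>.\<close>

lemma V_doubling:
  fixes a b :: "real ^ 'n" and l h :: real
  assumes l: "0 < l" and corner: "\<And>i. b $ i \<le> a $ i" "\<And>i. a $ i + l \<le> b $ i + h" and h6: "h \<le> 6 * l"
  shows "emeasure V (cbox b (b + (\<chi> i. h))) \<le> ennreal doubling_const * emeasure V (cbox a (a + (\<chi> i. l)))"
proof -
  define N where "N = nat \<lceil>20 * real CARD('n) * tail_level\<rceil>"
  have "20 * real CARD('n) * tail_level > 0" using tail_level_bounds(1) by (intro mult_pos_pos) auto
  hence N: "0 < N" "20 * real CARD('n) * tail_level \<le> real N" unfolding N_def by linarith+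
  have "a $ undefined + l \<le> a $ undefined + h"
    using corner[of undefined] by linarith
  hence h: "0 < h" "l \<le> h" using l by auto
  define z where "z t = a + t *\<^sub>R (b - a)" for t
  define e where "e t = l + t * (h - l)" for t :: real
  define P where "P i = cbox (z (i / N)) (z (i / N) + (\<chi> _. e (i / N)))" for i :: nat
  \<comment> \<open>consecutive sides differ by at most \<open>5 l / N\<close>, hence volumes by at most the fraction \<open>5 n / N\<close>\<close>
  have step: "emeasure V (P (Suc i)) \<le> ennreal 2 * emeasure V (P i)" for i
  proof -
    define t where "t = real i / N"
    have t: "0 \<le> t" by (simp add: t_def)
    have t': "real (Suc i) / N = t + 1 / N" using N by (simp add: t_def field_simps)
    have el: "l \<le> e t" "l \<le> e (t + 1 / N)" using t h by (auto simp: e_def)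
    have diff: "e (t + 1 / N) - e t = (h - l) / N" by (simp add: e_def algebra_simps add_divide_distrib)
    have zdiff: "z (t + 1 / N) $ j = z t $ j + (b $ j - a $ j) / N" for j
      by (simp add: z_def algebra_simps add_divide_distrib diff_divide_distrib)
    have "CARD('n) * (e (t + 1 / N) - e t) / e (t + 1 / N) \<le> CARD('n) * (e (t + 1 / N) - e t) / l"
      using el l h by (intro divide_left_mono) (auto simp: diff)
    also have "\<dots> \<le> CARD('n) * (5 * l / N) / l"
      unfolding diff using l h6 by (intro divide_right_mono mult_left_mono) auto
    also have "\<dots> = 5 * CARD('n) / N" using l by simp
    also have "\<dots> \<le> 1 / (4 * tail_level)"
      using N tail_level_bounds(1) by (simp add: field_simps)
    finally have close: "CARD('n) * (e (t + 1 / N) - e t) / e (t + 1 / N) \<le> 1 / (4 * tail_level)" .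
    show ?thesis
      unfolding P_def t' t_def[symmetric]
    proof (rule V_cube_le_twice[OF _ _ _ close])
      show "0 < e t" using el l by simp
      fix j
      show "z (t + 1 / N) $ j \<le> z t $ j"
        using corner(1)[of j] by (simp add: zdiff divide_nonpos_nonneg)
      have "0 \<le> (b $ j - a $ j + h - l) / N" using corner(2)[of j] by simp
      thus "z t $ j + e t \<le> z (t + 1 / N) $ j + e (t + 1 / N)"
        using diff zdiff[of j] by (simp add: add_divide_distrib diff_divide_distrib)
    qed
  qed
  have "emeasure V (P i) \<le> ennreal (2 ^ i) * emeasure V (P 0)" for i
  proof (induction i)
    case (Suc i)
    have "emeasure V (P (Suc i)) \<le> ennreal 2 * (ennreal (2 ^ i) * emeasure V (P 0))"
      using step Suc by (rule order_trans[OF _ mult_left_mono]) auto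
    also have "\<dots> = ennreal (2 ^ Suc i) * emeasure V (P 0)"
      by (simp add: ennreal_mult mult.assoc)
    finally show ?case .
  qed simp
  from this[of N] show ?thesis
    using N by (simp add: P_def z_def e_def doubling_const_def N_def[symmetric])
qed

lemma V_cubelike_le:
  fixes a b :: "real ^ 'n" and l h :: real
  assumes R: "cubelike b h R" and l: "0 < l"
    and corner: "\<And>i. b $ i \<le> a $ i" "\<And>i. a $ i + l \<le> b $ i + h" and h6: "h \<le> 6 * l"
  shows "emeasure V R \<le> ennreal doubling_const * emeasure V (cbox a (a + (\<chi> i. l)))"
proof -
  have "emeasure V R \<le> emeasure V (cbox b (b + (\<chi> i. h)))"
    using R by (intro emeasure_mono) (auto simp: cubelike_def)
  also have "\<dots> \<le> ennreal doubling_const * emeasure V (cbox a (a + (\<chi> i. l)))"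
    using assms by (intro V_doubling) auto
  finally show ?thesis .
qed

section \<open>The weighted inequality for finitely many cubes\<close>

text \<open>The relations that make the powers of \<open>v\<close> and of the partial sums match in the pointwise bound.\<close>

lemma exponent_identities:
  assumes "0 < p" "0 < q" "s = q / p" "\<gamma> = 1 / p - 1 / q"
  shows "p * \<gamma> = 1 - 1 / s" "\<gamma> * q = s - 1" "0 < \<gamma>"
proof -
  have q: "q = s * p" using assms by simp
  show "p * \<gamma> = 1 - 1 / s" "\<gamma> * q = s - 1"
    using assms(1) s_gt1 by (simp_all add: assms(4) q field_simps)
  have "\<gamma> = (s - 1) / q" using assms(1) s_gt1 by (simp add: assms(4) q field_simps)
  thus "0 < \<gamma>" using assms(2) s_gt1 by simp
qed

text \<open>For \<open>x \<in> E k\<close> the hypothesis on \<open>N\<close> bounds \<open>v x\<close> times the volume of \<open>R k\<close> by \<open>tail_level * N\<close>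
  divided by the \<open>p\<close>-th power of the inner sum. Thus every volume factor turns into a power of the inner
  sum with exponent \<open>1 / s - 1\<close>, and \<open>sum_above_powr_le\<close> with exponent \<open>1 / s\<close> adds them up.\<close>

lemma hedberg_pointwise:
  fixes R :: "'i \<Rightarrow> (real ^ 'n) set"
  assumes K: "finite K" "nested K R" "\<And>k. k \<in> K \<Longrightarrow> 0 < c k"
    and rh_mean: "\<And>k. k \<in> K \<Longrightarrow> rh_mean (R k) (m k)"
    and pq: "0 < p" "0 < q" "s = q / p" "\<gamma> = 1 / p - 1 / q"
    and N: "0 \<le> N" "\<And>k. k \<in> K \<Longrightarrow> sum_above K R c k powr p * (m k * measure lebesgue (R k)) \<le> N"
  defines "E \<equiv> \<lambda>k. {x \<in> R k. v x \<le> tail_level * m k}"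
  shows "(\<Sum>k\<in>K. c k * measure lebesgue (R k) powr \<gamma> * indicator (E k) x) powr q * v x powr s
    \<le> s powr q * (tail_level * N) powr (s - 1) * ((\<Sum>k\<in>K. c k * indicator (R k) x) powr p * v x)"
proof -
  let ?L = "\<lambda>k. measure lebesgue (R k)" and ?B = "\<lambda>k. sum_above K R c k"
  let ?f = "\<Sum>k\<in>K. c k * indicator (R k) x"
  define T where "T = tail_level * N / v x"
  have T: "0 \<le> T" using tail_level_bounds(1) N(1) v_pos[of x] by (simp add: T_def)
  note pg = exponent_identities[OF pq]
  have term_le: "c k * ?L k powr \<gamma> * indicator (E k) x
      \<le> T powr \<gamma> * (c k * ?B k powr (1 / s - 1) * indicator (E k) x)" if k: "k \<in> K" for k
  proof (cases "x \<in> E k")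
    case True
    have B: "0 < ?B k" using K k by (intro above_pos) auto
    have "v x * ?L k * ?B k powr p \<le> tail_level * m k * ?L k * ?B k powr p"
      using True by (intro mult_right_mono) (auto simp: E_def)
    also have "\<dots> = tail_level * (?B k powr p * (m k * ?L k))" by simp
    also have "\<dots> \<le> tail_level * N" using N(2)[OF k] tail_level_bounds(1) by (intro mult_left_mono) auto
    finally have "?L k \<le> T * ?B k powr (- p)"
      using v_pos[of x] B by (simp add: T_def powr_minus field_simps)
    hence "?L k powr \<gamma> \<le> (T * ?B k powr (- p)) powr \<gamma>"
      using pg by (intro powr_mono2) auto
    also have "\<dots> = T powr \<gamma> * ?B k powr (1 / s - 1)"
      using T pg(1) by (simp add: powr_mult powr_powr)
    finally show ?thesis using True K(3)[OF k] by (simp add: mult.left_commute mult_left_mono)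
  qed simp
  have "(\<Sum>k\<in>K. c k * ?L k powr \<gamma> * indicator (E k) x)
      \<le> T powr \<gamma> * (\<Sum>k\<in>K. c k * ?B k powr (1 / s - 1) * indicator (E k) x)"
    unfolding sum_distrib_left by (rule sum_mono[OF term_le])
  also have "\<dots> \<le> T powr \<gamma> * (s * ?f powr (1 / s))"
  proof (intro mult_left_mono)
    have "(1 / s) * (\<Sum>k\<in>K. c k * ?B k powr (1 / s - 1) * indicator (E k) x)
      \<le> (\<Sum>k\<in>K. c k * indicator (E k) x) powr (1 / s)"
      using s_gt1 by (intro sum_above_powr_le K) (auto simp: E_def)
    also have "\<dots> \<le> ?f powr (1 / s)"
    proof (rule powr_mono2)
      show "(\<Sum>k\<in>K. c k * indicator (E k) x) \<le> ?f"
        using K(3) by (intro sum_mono mult_left_mono) (auto simp: E_def indicator_def intro: less_imp_le)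
      show "0 \<le> (\<Sum>k\<in>K. c k * indicator (E k) x)"
        using K(3) by (intro sum_nonneg mult_nonneg_nonneg) (auto intro: less_imp_le)
    qed (use s_gt1 in auto)
    finally show "(\<Sum>k\<in>K. c k * ?B k powr (1 / s - 1) * indicator (E k) x) \<le> s * ?f powr (1 / s)"
      using s_gt1 by (simp add: field_simps)
  qed simp
  finally have "(\<Sum>k\<in>K. c k * ?L k powr \<gamma> * indicator (E k) x) \<le> T powr \<gamma> * (s * ?f powr (1 / s))" .
  hence "(\<Sum>k\<in>K. c k * ?L k powr \<gamma> * indicator (E k) x) powr q \<le> (T powr \<gamma> * (s * ?f powr (1 / s))) powr q"
    using K(3) pq(2)
    by (intro powr_mono2 sum_nonneg mult_nonneg_nonneg) (auto intro: less_imp_le)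
  also have "\<dots> = T powr (s - 1) * (s powr q * ?f powr p)"
  proof -
    have "1 / s * q = p" using pq by simp
    thus ?thesis by (simp only: powr_mult powr_powr pg(2))
  qed
  finally have "(\<Sum>k\<in>K. c k * ?L k powr \<gamma> * indicator (E k) x) powr q * v x powr s
    \<le> T powr (s - 1) * (s powr q * ?f powr p) * v x powr s"
    by (intro mult_right_mono) auto
  also have "\<dots> = s powr q * (tail_level * N) powr (s - 1) * (?f powr p * (v x powr s / v x powr (s - 1)))"
    by (simp add: T_def powr_divide)
  also have "v x powr s / v x powr (s - 1) = v x"
    using v_pos[of x] by (simp flip: powr_diff)
  finally show ?thesis .
qed

lemma nn_integral_U:
  assumes "f \<in> borel_measurable lebesgue"
  shows "(\<integral>\<^sup>+x. ennreal (f x powr r) \<partial>U) = (\<integral>\<^sup>+x. ennreal (f x powr r * v x powr s) \<partial>lebesgue)"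
proof -
  have [measurable]: "f \<in> borel_measurable lebesgue" by fact
  have "(\<integral>\<^sup>+x. ennreal (f x powr r) \<partial>U) = (\<integral>\<^sup>+x. ennreal (v x powr s) * ennreal (f x powr r) \<partial>lebesgue)"
    unfolding U_def by (intro nn_integral_density) measurable
  thus ?thesis by (simp add: mult.commute ennreal_mult)
qed

lemma nn_integral_V:
  assumes "f \<in> borel_measurable lebesgue"
  shows "(\<integral>\<^sup>+x. ennreal (f x powr r) \<partial>V) = (\<integral>\<^sup>+x. ennreal (f x powr r * v x) \<partial>lebesgue)"
proof -
  have [measurable]: "f \<in> borel_measurable lebesgue" by fact
  have "(\<integral>\<^sup>+x. ennreal (f x powr r) \<partial>V) = (\<integral>\<^sup>+x. ennreal (v x) * ennreal (f x powr r) \<partial>lebesgue)"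
    unfolding V_def by (intro nn_integral_density) measurable
  also have "\<dots> = (\<integral>\<^sup>+x. ennreal (f x powr r * v x) \<partial>lebesgue)"
    using v_pos by (intro nn_integral_cong) (simp add: mult.commute ennreal_mult less_imp_le)
  finally show ?thesis .
qed

lemma sum_indicator_measurable:
  fixes c :: "'i \<Rightarrow> real"
  assumes "\<And>k. k \<in> K \<Longrightarrow> R k \<in> sets lebesgue"
  shows "(\<lambda>x. \<Sum>k\<in>K. c k * indicator (R k) x) \<in> borel_measurable lebesgue"
  using assms
  by (intro borel_measurable_sum borel_measurable_times borel_measurable_const borel_measurable_indicator)

lemma hedberg_integral:
  fixes R :: "'i \<Rightarrow> (real ^ 'n) set"
  assumes K: "finite K" "nested K R" "\<And>k. k \<in> K \<Longrightarrow> 0 < c k"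
    and rh_mean: "\<And>k. k \<in> K \<Longrightarrow> rh_mean (R k) (m k)"
    and pq: "0 < p" "0 < q" "s = q / p" "\<gamma> = 1 / p - 1 / q"
    and N: "0 \<le> N" "(\<integral>\<^sup>+x. ennreal ((\<Sum>k\<in>K. c k * indicator (R k) x) powr p) \<partial>V) \<le> ennreal N"
  shows "(\<integral>\<^sup>+x. ennreal ((\<Sum>k\<in>K. c k * measure lebesgue (R k) powr \<gamma> *
        indicator {x \<in> R k. v x \<le> tail_level * m k} x) powr q) \<partial>U)
    \<le> ennreal (s powr q * tail_level powr (s - 1) * N powr s)"
proof -
  let ?f = "\<lambda>x. \<Sum>k\<in>K. c k * indicator (R k) x"
  let ?C = "s powr q * (tail_level * N) powr (s - 1)"
  have R: "R k \<in> sets lebesgue" if "k \<in> K" for k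
    using rh_mean[OF that] by (auto simp: rh_mean_def)
  have B: "sum_above K R c k powr p * (m k * measure lebesgue (R k)) \<le> N" if k: "k \<in> K" for k
  proof -
    have m: "0 < m k" "emeasure V (R k) = ennreal (m k * measure lebesgue (R k))"
      using rh_mean[OF k] by (auto simp: rh_mean_def)
    have "ennreal (sum_above K R c k powr p * (m k * measure lebesgue (R k)))
        = ennreal (sum_above K R c k powr p) * emeasure V (R k)"
      using m by (simp only: m(2)) (intro ennreal_mult, auto)
    also have "\<dots> = (\<integral>\<^sup>+x. ennreal (sum_above K R c k powr p) * indicator (R k) x \<partial>V)"
      using R[OF k] by (intro nn_integral_cmult_indicator[symmetric]) simp
    also have "\<dots> \<le> (\<integral>\<^sup>+x. ennreal (?f x powr p) \<partial>V)"
    proof (intro nn_integral_mono)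
      fix x
      show "ennreal (sum_above K R c k powr p) * indicator (R k) x \<le> ennreal (?f x powr p)"
      proof (cases "x \<in> R k")
        case True
        have "sum_above K R c k powr p \<le> ?f x powr p"
          using True K k pq(1) above_pos[of K c k R]
          by (intro powr_mono2 above_le_sum) (auto intro: less_imp_le)
        thus ?thesis using True by (simp add: ennreal_leI)
      qed simp
    qed
    also note N(2)
    finally show ?thesis using N(1) by (simp add: ennreal_le_iff)
  qed
  have "(\<integral>\<^sup>+x. ennreal ((\<Sum>k\<in>K. c k * measure lebesgue (R k) powr \<gamma> *
        indicator {x \<in> R k. v x \<le> tail_level * m k} x) powr q) \<partial>U)
     = (\<integral>\<^sup>+x. ennreal ((\<Sum>k\<in>K. c k * measure lebesgue (R k) powr \<gamma> *
        indicator {x \<in> R k. v x \<le> tail_level * m k} x) powr q * v x powr s) \<partial>lebesgue)"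
    by (intro nn_integral_U sum_indicator_measurable level_set_sets R)
  also have "\<dots> \<le> (\<integral>\<^sup>+x. ennreal (?C * (?f x powr p * v x)) \<partial>lebesgue)"
    using K rh_mean pq N(1) B by (intro nn_integral_mono ennreal_leI hedberg_pointwise) auto
  also have "\<dots> = (\<integral>\<^sup>+x. ennreal ?C * ennreal (?f x powr p * v x) \<partial>lebesgue)"
    by (intro nn_integral_cong ennreal_mult mult_nonneg_nonneg) (auto intro: less_imp_le[OF v_pos])
  also have "\<dots> = ennreal ?C * (\<integral>\<^sup>+x. ennreal (?f x powr p * v x) \<partial>lebesgue)"
  proof (intro nn_integral_cmult)
    have [measurable]: "?f \<in> borel_measurable lebesgue"
      by (intro sum_indicator_measurable R)
    show "(\<lambda>x. ennreal (?f x powr p * v x)) \<in> borel_measurable lebesgue" by measurable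
  qed
  also have "(\<integral>\<^sup>+x. ennreal (?f x powr p * v x) \<partial>lebesgue) = (\<integral>\<^sup>+x. ennreal (?f x powr p) \<partial>V)"
    by (intro nn_integral_V[symmetric] sum_indicator_measurable R)
  also have "ennreal ?C * \<dots> \<le> ennreal ?C * ennreal N"
    using N(2) by (intro mult_left_mono) auto
  also have "\<dots> = ennreal (?C * N)" using N(1) by (intro ennreal_mult[symmetric]) auto
  also have "?C * N = s powr q * tail_level powr (s - 1) * N powr s"
    using N(1) tail_level_bounds(1) powr_mult_base[of N "s - 1"] by (simp add: powr_mult mult_ac)
  finally show ?thesis .
qed

definition grid_const :: "real \<Rightarrow> real \<Rightarrow> real" where
  "grid_const p q = stretch_const (4 powr s * A) q * (s powr q * tail_level powr (s - 1) * stretch_const doubling_const p powr s)"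

lemma grid_const_nonneg: "0 < p \<Longrightarrow> 0 < q \<Longrightarrow> 0 \<le> grid_const p q"
  using A_pos by (simp add: grid_const_def stretch_const_def doubling_const_def)

text \<open>Enlarge \<open>Q\<close> to \<open>R\<close> on the left, which only increases the sum; shrink \<open>R\<close> to the part where the
  weight is bounded, use the pointwise bound there, and finally return from \<open>R\<close> to \<open>Q\<close> on the side of
  \<open>p\<close>.\<close>

lemma one_grid:
  fixes R :: "'i \<Rightarrow> (real ^ 'n) set"
  assumes K: "finite K" "nested K R" "\<And>k. k \<in> K \<Longrightarrow> 0 < c k"
    and l: "\<And>k. k \<in> K \<Longrightarrow> 0 < l k"
    and R: "\<And>k. k \<in> K \<Longrightarrow> cubelike (b k) (h k) (R k)"
    and QR: "\<And>k. k \<in> K \<Longrightarrow> cbox (a k) (a k + (\<chi> i. l k)) \<subseteq> R k"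
    and h: "\<And>k. k \<in> K \<Longrightarrow> h k \<le> 6 * l k"
    and corner: "\<And>k i. k \<in> K \<Longrightarrow> b k $ i \<le> a k $ i \<and> a k $ i + l k \<le> b k $ i + h k"
    and pq: "0 < p" "0 < q" "s = q / p" "\<gamma> = 1 / p - 1 / q"
  defines "Q \<equiv> \<lambda>k. cbox (a k) (a k + (\<chi> i. l k))"
  assumes N: "0 \<le> N" "(\<integral>\<^sup>+x. ennreal ((\<Sum>k\<in>K. c k * indicator (Q k) x) powr p) \<partial>V) \<le> ennreal N"
  shows "(\<integral>\<^sup>+x. ennreal ((\<Sum>k\<in>K. c k * measure lebesgue (Q k) powr \<gamma> * indicator (Q k) x) powr q) \<partial>U)
    \<le> ennreal (grid_const p q * N powr s)"
proof -
  have "\<forall>k\<in>K. \<exists>m. rh_mean (R k) m" using R cubelike_rh_mean by blast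
  then obtain m where m: "\<And>k. k \<in> K \<Longrightarrow> rh_mean (R k) (m k)" by metis
  let ?c = "\<lambda>k. c k * measure lebesgue (R k) powr \<gamma>"
  let ?E = "\<lambda>k. {x \<in> R k. v x \<le> tail_level * m k}"
  have Rs: "R k \<in> sets lebesgue" if "k \<in> K" for k using R[OF that] by (rule cubelike_sets)
  have Q_sub: "Q k \<subseteq> R k" if "k \<in> K" for k using QR[OF that] by (simp add: Q_def)
  note \<gamma> = exponent_identities(3)[OF pq]
  have D: "0 < doubling_const" by (simp add: doubling_const_def)
  have "(\<integral>\<^sup>+x. ennreal ((\<Sum>k\<in>K. c k * indicator (R k) x) powr p) \<partial>V)
      \<le> ennreal (stretch_const doubling_const p) * (\<integral>\<^sup>+x. ennreal ((\<Sum>k\<in>K. c k * indicator (Q k) x) powr p) \<partial>V)"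
  proof (rule nested_stretch[OF K])
    fix k assume k: "k \<in> K"
    show "emeasure V (R k) < \<infinity>" using m[OF k] by (simp add: rh_mean_def)
    show "emeasure V (R k) \<le> ennreal doubling_const * emeasure V (Q k)"
      unfolding Q_def using R[OF k] l[OF k] h[OF k] corner[OF k] by (intro V_cubelike_le) auto
  qed (use Rs Q_sub pq(1) D in \<open>auto simp: Q_def\<close>)
  also have "\<dots> \<le> ennreal (stretch_const doubling_const p) * ennreal N"
    using N(2) by (intro mult_left_mono) auto
  also have "\<dots> = ennreal (stretch_const doubling_const p * N)"
    using N(1) pq(1) by (intro ennreal_mult[symmetric]) (auto simp: stretch_const_def doubling_const_def)
  finally have fR: "(\<integral>\<^sup>+x. ennreal ((\<Sum>k\<in>K. c k * indicator (R k) x) powr p) \<partial>V)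
      \<le> ennreal (stretch_const doubling_const p * N)" .
  have SN: "0 \<le> stretch_const doubling_const p * N"
    using N(1) pq(1) D by (simp add: stretch_const_def)
  have "(\<integral>\<^sup>+x. ennreal ((\<Sum>k\<in>K. c k * measure lebesgue (Q k) powr \<gamma> * indicator (Q k) x) powr q) \<partial>U)
      \<le> (\<integral>\<^sup>+x. ennreal ((\<Sum>k\<in>K. ?c k * indicator (R k) x) powr q) \<partial>U)"
  proof (intro nn_integral_mono ennreal_leI powr_mono2 sum_mono mult_mono)
    fix x k assume k: "k \<in> K"
    have "R k \<in> lmeasurable" using m[OF k] by (simp add: rh_mean_def)
    thus "measure lebesgue (Q k) \<le> measure lebesgue (R k)"
      using Q_sub[OF k] by (intro measure_mono_fmeasurable) (auto simp: Q_def)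
    show "indicator (Q k) x \<le> (indicator (R k) x :: real)"
      using Q_sub[OF k] by (auto simp: indicator_def)
  qed (use K(3) \<gamma> pq(2) in \<open>auto intro!: sum_nonneg mult_nonneg_nonneg intro: less_imp_le\<close>)
  also have "\<dots> \<le> ennreal (stretch_const (4 powr s * A) q) *
      (\<integral>\<^sup>+x. ennreal ((\<Sum>k\<in>K. ?c k * indicator (?E k) x) powr q) \<partial>U)"
  proof (rule nested_stretch[OF K(1,2)])
    fix k assume k: "k \<in> K"
    show "0 < ?c k"
      using K(3)[OF k] R[OF k] cubelike_emeasure(2)[OF R[OF k]] by (simp add: cubelike_def)
    show "emeasure U (R k) < \<infinity>" using m[OF k] by (rule rh_mean_U_finite)
    show "emeasure U (R k) \<le> ennreal (4 powr s * A) * emeasure U (?E k)"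
      using m[OF k] by (rule U_le_of_bounded_part)
    show "?E k \<in> sets U" using Rs[OF k] by (simp add: level_set_sets)
  qed (use Rs pq(2) A_pos in auto)
  also have "\<dots> \<le> ennreal (stretch_const (4 powr s * A) q) *
      ennreal (s powr q * tail_level powr (s - 1) * (stretch_const doubling_const p * N) powr s)"
    using SN by (intro mult_left_mono hedberg_integral[OF K m pq _ fR]) auto
  also have "\<dots> = ennreal (stretch_const (4 powr s * A) q *
      (s powr q * tail_level powr (s - 1) * (stretch_const doubling_const p * N) powr s))"
    using pq(2) A_pos by (intro ennreal_mult[symmetric]) (auto simp: stretch_const_def)
  also have "stretch_const (4 powr s * A) q *
      (s powr q * tail_level powr (s - 1) * (stretch_const doubling_const p * N) powr s) = grid_const p q * N powr s"
    by (simp add: grid_const_def powr_mult)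
  finally show ?thesis .
qed

text \<open>The grids are labelled by sets of coordinates; one factor is their number and the other one
  comes from \<open>sum_powr_le\<close>.\<close>

definition total_const :: "real \<Rightarrow> real \<Rightarrow> real" where
  "total_const p q = real CARD('n set) powr q * (real CARD('n set) * grid_const p q)"

lemma finite_sum_of_cubes:
  fixes a :: "'i \<Rightarrow> real ^ 'n"
  assumes K: "finite K" and c: "\<And>k. k \<in> K \<Longrightarrow> 0 < c k"
    and l: "\<And>k. k \<in> K \<Longrightarrow> 0 < l k"
    and pq: "0 < p" "0 < q" "s = q / p" "\<gamma> = 1 / p - 1 / q"
  defines "Q \<equiv> \<lambda>k. cbox (a k) (a k + (\<chi> i. l k))"
  assumes N: "0 \<le> N" "(\<integral>\<^sup>+x. ennreal ((\<Sum>k\<in>K. c k * indicator (Q k) x) powr p) \<partial>V) \<le> ennreal N"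
  shows "(\<integral>\<^sup>+x. ennreal ((\<Sum>k\<in>K. c k * measure lebesgue (Q k) powr \<gamma> * indicator (Q k) x) powr q) \<partial>U)
    \<le> ennreal (total_const p q * N powr s)"
proof -
  obtain T :: "'i \<Rightarrow> 'n set" and b h R where
    nest: "\<And>S. nested {k \<in> K. T k = S} R" and
    R: "\<And>k. k \<in> K \<Longrightarrow> cubelike (b k) (h k) (R k)" "\<And>k. k \<in> K \<Longrightarrow> Q k \<subseteq> R k" "\<And>k. k \<in> K \<Longrightarrow> h k \<le> 6 * l k"
       "\<And>k i. k \<in> K \<Longrightarrow> b k $ i \<le> a k $ i \<and> a k $ i + l k \<le> b k $ i + h k"
    using cubes_in_shifted_grids[where K = K and l = l and a = a, OF K l] unfolding Q_def by blast
  let ?n = "real CARD('n set)"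
  let ?J = "\<lambda>S x. \<Sum>k | k \<in> K \<and> T k = S. c k * measure lebesgue (Q k) powr \<gamma> * indicator (Q k) x"
  have J_meas: "(\<lambda>x. ennreal (?J S x powr q)) \<in> borel_measurable U" for S
    by (intro measurable_sum_indicator_powr) (simp add: Q_def)
  have J_nonneg: "0 \<le> ?J S x" for S x
    using c by (intro sum_nonneg mult_nonneg_nonneg) (auto intro: less_imp_le)
  have J_le: "(\<integral>\<^sup>+x. ennreal (?J S x powr q) \<partial>U) \<le> ennreal (grid_const p q * N powr s)" for S
    unfolding Q_def
  proof (rule one_grid[where R = R and b = b and h = h, OF _ nest])
    have "(\<integral>\<^sup>+x. ennreal ((\<Sum>k | k \<in> K \<and> T k = S. c k * indicator (Q k) x) powr p) \<partial>V)
        \<le> (\<integral>\<^sup>+x. ennreal ((\<Sum>k\<in>K. c k * indicator (Q k) x) powr p) \<partial>V)"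
    proof (intro nn_integral_mono ennreal_leI powr_mono2 sum_mono2)
      fix x show "0 \<le> (\<Sum>k | k \<in> K \<and> T k = S. c k * indicator (Q k) x)"
        using c by (intro sum_nonneg mult_nonneg_nonneg) (auto intro: less_imp_le)
    qed (use K c pq(1) in \<open>auto intro!: mult_nonneg_nonneg intro: less_imp_le\<close>)
    thus "(\<integral>\<^sup>+x. ennreal ((\<Sum>k | k \<in> K \<and> T k = S. c k * indicator (cbox (a k) (a k + (\<chi> i. l k))) x) powr p) \<partial>V) \<le> ennreal N"
      using N(2) unfolding Q_def by (rule order_trans)
  qed (use K c l pq N(1) R in \<open>auto simp: Q_def\<close>)
  have "(\<integral>\<^sup>+x. ennreal ((\<Sum>k\<in>K. c k * measure lebesgue (Q k) powr \<gamma> * indicator (Q k) x) powr q) \<partial>U)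
      \<le> (\<integral>\<^sup>+x. ennreal (?n powr q) * (\<Sum>S\<in>UNIV. ennreal (?J S x powr q)) \<partial>U)"
  proof (rule nn_integral_mono)
    fix x
    have "(\<Sum>k\<in>K. c k * measure lebesgue (Q k) powr \<gamma> * indicator (Q k) x) = (\<Sum>S\<in>UNIV. ?J S x)"
      using K by (intro sum.group[symmetric]) auto
    hence "(\<Sum>k\<in>K. c k * measure lebesgue (Q k) powr \<gamma> * indicator (Q k) x) powr q
        \<le> ?n powr q * (\<Sum>S\<in>UNIV. ?J S x powr q)"
      using sum_powr_le[of UNIV "\<lambda>S. ?J S x" q] J_nonneg pq(2) by simp
    hence "ennreal ((\<Sum>k\<in>K. c k * measure lebesgue (Q k) powr \<gamma> * indicator (Q k) x) powr q)
        \<le> ennreal (?n powr q * (\<Sum>S\<in>UNIV. ?J S x powr q))" by (rule ennreal_leI)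
    also have "\<dots> = ennreal (?n powr q) * ennreal (\<Sum>S\<in>UNIV. ?J S x powr q)"
      by (intro ennreal_mult sum_nonneg) auto
    also have "ennreal (\<Sum>S\<in>UNIV. ?J S x powr q) = (\<Sum>S\<in>UNIV. ennreal (?J S x powr q))"
      by (intro sum_ennreal[symmetric]) auto
    finally show "ennreal ((\<Sum>k\<in>K. c k * measure lebesgue (Q k) powr \<gamma> * indicator (Q k) x) powr q)
        \<le> ennreal (?n powr q) * (\<Sum>S\<in>UNIV. ennreal (?J S x powr q))" .
  qed
  also have "\<dots> = ennreal (?n powr q) * (\<integral>\<^sup>+x. (\<Sum>S\<in>UNIV. ennreal (?J S x powr q)) \<partial>U)"
    using J_meas by (intro nn_integral_cmult borel_measurable_sum)
  also have "(\<integral>\<^sup>+x. (\<Sum>S\<in>UNIV. ennreal (?J S x powr q)) \<partial>U) = (\<Sum>S\<in>UNIV. \<integral>\<^sup>+x. ennreal (?J S x powr q) \<partial>U)"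
    using J_meas by (intro nn_integral_sum)
  also have "ennreal (?n powr q) * \<dots> \<le> ennreal (?n powr q) * (\<Sum>S::'n set\<in>UNIV. ennreal (grid_const p q * N powr s))"
    using J_le by (intro mult_left_mono sum_mono) auto
  also have "(\<Sum>S::'n set\<in>UNIV. ennreal (grid_const p q * N powr s)) = ennreal (?n * (grid_const p q * N powr s))"
    using grid_const_nonneg[OF pq(1,2)] by (subst sum_ennreal) auto
  also have "ennreal (?n powr q) * \<dots> = ennreal (?n powr q * (?n * (grid_const p q * N powr s)))"
    using grid_const_nonneg[OF pq(1,2)] by (intro ennreal_mult[symmetric]) auto
  also have "?n powr q * (?n * (grid_const p q * N powr s)) = total_const p q * N powr s"
    by (simp add: total_const_def)
  finally show ?thesis .
qed

end

section \<open>Countable families and extended powers\<close>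

lemma epowr_ennreal: "0 \<le> t \<Longrightarrow> epowr (ennreal t) a = ennreal (t powr a)"
  by (simp add: epowr_def)

lemma epowr_mono:
  assumes "x \<le> y" "0 < a"
  shows "epowr x a \<le> epowr y a"
proof (cases "y = \<infinity>")
  case False
  then obtain u where u: "y = ennreal u" "0 \<le> u" by (cases y) auto
  have "x \<noteq> \<infinity>" using assms(1) False by (auto simp: top_unique)
  then obtain t where t: "x = ennreal t" "0 \<le> t" by (cases x) auto
  have "t \<le> u" using assms(1) t u by simp
  thus ?thesis using t u assms(2) by (simp add: epowr_ennreal ennreal_leI powr_mono2)
qed (simp add: epowr_def)

lemma infsum_ennreal_eq_SUP:
  fixes g :: "nat \<Rightarrow> real"
  assumes "\<And>k. k \<in> K \<Longrightarrow> 0 \<le> g k"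
  shows "(\<Sum>\<^sub>\<infinity>k\<in>K. ennreal (g k)) = (SUP N. ennreal (\<Sum>k\<in>K \<inter> {..<N}. g k))"
proof -
  have eq: "ennreal (\<Sum>k\<in>F. g k) = (\<Sum>k\<in>F. ennreal (g k))" if "F \<subseteq> K" for F
    using assms that by (intro sum_ennreal[symmetric]) auto
  have "(\<Sum>\<^sub>\<infinity>k\<in>K. ennreal (g k)) = (SUP F\<in>{F. finite F \<and> F \<subseteq> K}. \<Sum>k\<in>F. ennreal (g k))"
    by (rule nonneg_infsum_complete) simp
  also have "\<dots> = (SUP N. \<Sum>k\<in>K \<inter> {..<N}. ennreal (g k))"
  proof (rule antisym)
    show "(SUP F\<in>{F. finite F \<and> F \<subseteq> K}. \<Sum>k\<in>F. ennreal (g k)) \<le> (SUP N. \<Sum>k\<in>K \<inter> {..<N}. ennreal (g k))"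
    proof (rule SUP_mono)
      fix F assume F: "F \<in> {F. finite F \<and> F \<subseteq> K}"
      then obtain N where "F \<subseteq> {..<N}" using finite_nat_bounded[of F] by blast
      hence "(\<Sum>k\<in>F. ennreal (g k)) \<le> (\<Sum>k\<in>K \<inter> {..<N}. ennreal (g k))"
        using F by (intro sum_mono2) auto
      thus "\<exists>N\<in>UNIV. (\<Sum>k\<in>F. ennreal (g k)) \<le> (\<Sum>k\<in>K \<inter> {..<N}. ennreal (g k))" by blast
    qed
    show "(SUP N. \<Sum>k\<in>K \<inter> {..<N}. ennreal (g k)) \<le> (SUP F\<in>{F. finite F \<and> F \<subseteq> K}. \<Sum>k\<in>F. ennreal (g k))"
      by (intro SUP_least SUP_upper) simp
  qed
  also have "\<dots> = (SUP N. ennreal (\<Sum>k\<in>K \<inter> {..<N}. g k))"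
    by (simp add: eq)
  finally show ?thesis .
qed

text \<open>Monotonicity of the inverse power suffices for this half of the continuity of \<open>epowr\<close>.\<close>

lemma epowr_SUP_le:
  fixes G :: "nat \<Rightarrow> real"
  assumes "\<And>i. 0 \<le> G i" "0 < a"
  shows "epowr (SUP i. ennreal (G i)) a \<le> (SUP i. ennreal (G i powr a))"
proof (cases "SUP i. ennreal (G i powr a)")
  case (real t)
  have "ennreal (G i) \<le> ennreal (t powr (1 / a))" for i
  proof (rule ennreal_leI)
    have "ennreal (G i powr a) \<le> ennreal t"
      unfolding real(2)[symmetric] by (rule SUP_upper) simp
    hence "G i powr a \<le> t" using real(1) by (simp add: ennreal_le_iff)
    hence "(G i powr a) powr (1 / a) \<le> t powr (1 / a)"
      using assms(2) by (intro powr_mono2) auto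
    thus "G i \<le> t powr (1 / a)" using assms by (simp add: powr_powr)
  qed
  hence "epowr (SUP i. ennreal (G i)) a \<le> epowr (ennreal (t powr (1 / a))) a"
    using assms(2) by (intro epowr_mono SUP_least)
  also have "\<dots> = ennreal t"
    using real(1) assms(2) by (simp add: epowr_ennreal powr_powr)
  finally show ?thesis using real(2) by simp
next
  case top
  show ?thesis unfolding top by simp
qed

lemma measurable_epowr_infsum:
  fixes g :: "nat \<Rightarrow> 'a \<Rightarrow> real"
  assumes "\<And>k x. k \<in> K \<Longrightarrow> 0 \<le> g k x" "\<And>k. k \<in> K \<Longrightarrow> g k \<in> borel_measurable M"
  shows "(\<lambda>x. epowr (\<Sum>\<^sub>\<infinity>k\<in>K. ennreal (g k x)) a) \<in> borel_measurable M"
proof -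
  have [measurable]: "(\<lambda>x. \<Sum>k\<in>K \<inter> {..<N}. g k x) \<in> borel_measurable M" for N
    using assms(2) by (intro borel_measurable_sum) auto
  have [measurable]: "(\<lambda>x. \<Sum>\<^sub>\<infinity>k\<in>K. ennreal (g k x)) \<in> borel_measurable M"
    by (simp add: infsum_ennreal_eq_SUP assms(1)) measurable
  show ?thesis unfolding epowr_def by measurable
qed

text \<open>Monotone convergence reduces a countable family to its finite initial parts.\<close>

lemma infsum_powr_weighted_le:
  fixes g :: "nat \<Rightarrow> 'a \<Rightarrow> real"
  assumes g: "\<And>k x. k \<in> K \<Longrightarrow> 0 \<le> g k x" "\<And>k. k \<in> K \<Longrightarrow> g k \<in> borel_measurable M"
    and a: "0 < a"
    and le: "\<And>N. (\<integral>\<^sup>+x. ennreal ((\<Sum>k\<in>K \<inter> {..<N}. g k x) powr a) \<partial>M) \<le> B"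
  shows "(\<integral>\<^sup>+x. epowr (\<Sum>\<^sub>\<infinity>k\<in>K. ennreal (g k x)) a \<partial>M) \<le> B"
proof -
  let ?G = "\<lambda>N x. \<Sum>k\<in>K \<inter> {..<N}. g k x"
  have G: "0 \<le> ?G N x" for N x using g(1) by (intro sum_nonneg) auto
  have [measurable]: "?G N \<in> borel_measurable M" for N
    using g(2) by (intro borel_measurable_sum) auto
  have inc: "incseq (\<lambda>N x. ennreal (?G N x powr a))"
    using G a g(1)
    by (intro incseq_SucI le_funI ennreal_leI powr_mono2 sum_mono2) auto
  have "(\<integral>\<^sup>+x. epowr (\<Sum>\<^sub>\<infinity>k\<in>K. ennreal (g k x)) a \<partial>M) \<le> (\<integral>\<^sup>+x. (SUP N. ennreal (?G N x powr a)) \<partial>M)"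
    using G a by (intro nn_integral_mono) (simp add: infsum_ennreal_eq_SUP g(1) epowr_SUP_le)
  also have "\<dots> = (SUP N. \<integral>\<^sup>+x. ennreal (?G N x powr a) \<partial>M)"
    by (rule nn_integral_monotone_convergence_SUP[OF inc]) measurable
  also have "\<dots> \<le> B" by (intro SUP_least le)
  finally show ?thesis .
qed

lemma sum_powr_le_epowr_infsum:
  fixes g :: "nat \<Rightarrow> real"
  assumes "\<And>k. k \<in> K \<Longrightarrow> 0 \<le> g k" "0 < a"
  shows "ennreal ((\<Sum>k\<in>K \<inter> {..<N}. g k) powr a) \<le> epowr (\<Sum>\<^sub>\<infinity>k\<in>K. ennreal (g k)) a"
proof -
  have "(\<Sum>\<^sub>\<infinity>k\<in>K. ennreal (g k)) = (SUP N. ennreal (\<Sum>k\<in>K \<inter> {..<N}. g k))"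
    using assms(1) by (rule infsum_ennreal_eq_SUP)
  hence "ennreal (\<Sum>k\<in>K \<inter> {..<N}. g k) \<le> (\<Sum>\<^sub>\<infinity>k\<in>K. ennreal (g k))"
    by (simp only:) (rule SUP_upper[OF UNIV_I])
  hence "epowr (ennreal (\<Sum>k\<in>K \<inter> {..<N}. g k)) a \<le> epowr (\<Sum>\<^sub>\<infinity>k\<in>K. ennreal (g k)) a"
    using assms(2) by (rule epowr_mono)
  moreover have "0 \<le> (\<Sum>k\<in>K \<inter> {..<N}. g k)"
    using assms(1) by (intro sum_nonneg) auto
  ultimately show ?thesis by (simp only: epowr_ennreal)
qed

section \<open>The weighted inequality for countable families\<close>

text \<open>Passing to real numbers: on a cube the mean of the weight is finite by local integrability and
  positive as the weight is, and then the mean of its power is finite as well.\<close>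

lemma RH_imp_reverse_holder_weight:
  fixes u :: "real ^ 'n \<Rightarrow> ennreal" and v :: "real ^ 'n \<Rightarrow> real"
  assumes RH: "u \<in> RH s" and s: "1 < s"
    and v: "v \<in> borel_measurable lebesgue" "\<And>x. 0 < v x" "AE x in lebesgue. u x = ennreal (v x)"
  shows "\<exists>A. reverse_holder_weight v s A"
proof -
  obtain C :: real where C: "\<And>Q. is_cube Q \<Longrightarrow>
      epowr (average Q (\<lambda>x. epowr (u x) s)) (1 / s) \<le> ennreal C * average Q u"
    and u: "weight u"
    using RH unfolding RH_def by auto
  let ?C = "max C 1"
  have "reverse_holder_weight v s (?C powr s)"
  proof
    fix l :: real and a :: "real ^ 'n" assume l: "0 < l"
    let ?Q = "cbox a (a + (\<chi> i. l))"
    define L where "L = l ^ CARD('n)"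
    have L: "0 < L" using l by (simp add: L_def)
    have cubelike: "cubelike a l ?Q" using l by (simp add: cubelike_def box_subset_cbox)
    have eQ: "emeasure lebesgue ?Q = ennreal L"
      using cubelike_emeasure(1)[OF cubelike] by (simp add: L_def)
    have is_cube: "is_cube ?Q" using l by (auto simp: is_cube_def)
    have Iu: "(\<integral>\<^sup>+x\<in>?Q. u x \<partial>lebesgue) = (\<integral>\<^sup>+x\<in>?Q. ennreal (v x) \<partial>lebesgue)"
      using v(3) by (intro nn_integral_cong_AE) auto
    have Ius: "(\<integral>\<^sup>+x\<in>?Q. epowr (u x) s \<partial>lebesgue) = (\<integral>\<^sup>+x\<in>?Q. ennreal (v x powr s) \<partial>lebesgue)"
      using v(3) by (intro nn_integral_cong_AE) (auto simp: epowr_ennreal v(2) less_imp_le)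
    have "(\<integral>\<^sup>+x\<in>?Q. ennreal (v x) \<partial>lebesgue) < \<infinity>"
      using u compact_cbox unfolding weight_def Iu[symmetric] by blast
    then obtain t where t: "(\<integral>\<^sup>+x\<in>?Q. ennreal (v x) \<partial>lebesgue) = ennreal t" "0 \<le> t"
      by (cases "\<integral>\<^sup>+x\<in>?Q. ennreal (v x) \<partial>lebesgue") auto
    have "t \<noteq> 0"
    proof
      assume "t = 0"
      hence "(\<integral>\<^sup>+x\<in>?Q. ennreal (v x) \<partial>lebesgue) = 0" using t by simp
      moreover have [measurable]: "v \<in> borel_measurable lebesgue" "?Q \<in> sets lebesgue"
        using v(1) by auto
      have "(\<lambda>x. ennreal (v x) * indicator ?Q x) \<in> borel_measurable lebesgue"
        by measurable
      ultimately have "AE x in lebesgue. ennreal (v x) * indicator ?Q x = 0"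
        by (simp add: nn_integral_0_iff_AE)
      hence "AE x in lebesgue. x \<notin> ?Q"
      proof eventually_elim
        case (elim x)
        thus ?case using v(2)[of x] by (simp add: ennreal_eq_0_iff split: split_indicator_asm)
      qed
      hence "emeasure lebesgue ?Q = 0"
        by (subst (asm) AE_iff_measurable[where N = "?Q"]) auto
      thus False using eQ L by simp
    qed
    define m where "m = t / L"
    have m: "0 < m" using t(2) \<open>t \<noteq> 0\<close> L by (simp add: m_def)
    have tm: "t = m * L" using L by (simp add: m_def)
    have avg_u: "average ?Q u = ennreal m"
      unfolding average_def Iu t(1) eQ using L t(2) by (simp add: divide_ennreal m_def)
    let ?X = "average ?Q (\<lambda>x. epowr (u x) s)"
    have "epowr ?X (1 / s) \<le> ennreal C * ennreal m"
      using C[OF is_cube] unfolding avg_u .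
    also have "\<dots> \<le> ennreal ?C * ennreal m" by (intro mult_right_mono ennreal_leI) auto
    also have "\<dots> = ennreal (?C * m)" using m by (intro ennreal_mult[symmetric]) auto
    finally have X_le: "epowr ?X (1 / s) \<le> ennreal (?C * m)" .
    have "?X \<noteq> \<infinity>" using X_le by (auto simp: epowr_def top_unique)
    then obtain y where y: "?X = ennreal y" "0 \<le> y" by (cases ?X) auto
    have "y powr (1 / s) \<le> ?C * m"
      using X_le y m by (simp add: epowr_ennreal ennreal_le_iff)
    hence "(y powr (1 / s)) powr s \<le> (?C * m) powr s" using s by (intro powr_mono2) auto
    hence y_le: "y \<le> ?C powr s * m powr s" using s y(2) by (simp add: powr_powr powr_mult)
    have "I = I / ennreal L * ennreal L" for I
      using L ennreal_mult_divide_eq[of "ennreal L" I]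
      by (simp add: ennreal_times_divide mult.commute[of _ "ennreal L"])
    hence "(\<integral>\<^sup>+x\<in>?Q. ennreal (v x powr s) \<partial>lebesgue) = ?X * ennreal L"
      unfolding average_def Ius eQ .
    also have "\<dots> = ennreal (y * L)" using y L by (simp add: ennreal_mult)
    also have "\<dots> \<le> ennreal (?C powr s * m powr s * L)"
      using y_le L by (intro ennreal_leI mult_right_mono) auto
    finally have "(\<integral>\<^sup>+x\<in>?Q. ennreal (v x powr s) \<partial>lebesgue) \<le> ennreal (?C powr s * m powr s * L)" .
    thus "\<exists>m>0. (\<integral>\<^sup>+x\<in>?Q. ennreal (v x) \<partial>lebesgue) = ennreal (m * l ^ CARD('n)) \<and>
      (\<integral>\<^sup>+x\<in>?Q. ennreal (v x powr s) \<partial>lebesgue) \<le> ennreal (?C powr s * m powr s * l ^ CARD('n))"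
      using m t(1) unfolding tm L_def by blast
  qed (use v s in auto)
  thus ?thesis by blast
qed

theorem lemma4p9:
  fixes \<alpha> p q :: real and w :: "real ^ 'n \<Rightarrow> ennreal"
  assumes "0 < \<alpha>" and "\<alpha> < real CARD('n)"
    and "0 < p" and "p < real CARD('n) / \<alpha>"
    and "1 / q = 1 / p - \<alpha> / real CARD('n)"
    and "weight w"
    and "(\<lambda>x. epowr (w x) p) \<in> RH (q / p)"
  shows "\<exists>C::real. \<forall>(K::nat set) (Q :: nat \<Rightarrow> (real ^ 'n) set) (c :: nat \<Rightarrow> real).
    (\<forall>k\<in>K. is_cube (Q k) \<and> 0 < c k) \<longrightarrow>
      Lp_norm q (\<lambda>x. epowr (w x) q)
        (\<lambda>x. \<Sum>\<^sub>\<infinity>k\<in>K. ennreal (c k * measure lebesgue (Q k) powr (\<alpha> / real CARD('n)) * indicator (Q k) x))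
      \<le> ennreal C * Lp_norm p (\<lambda>x. epowr (w x) p)
        (\<lambda>x. \<Sum>\<^sub>\<infinity>k\<in>K. ennreal (c k * indicator (Q k) x))"
proof -
  define \<gamma> where "\<gamma> = \<alpha> / real CARD('n)"
  define s where "s = q / p"
  have "\<gamma> < 1 / p" using assms(1,3,4) by (simp add: \<gamma>_def field_simps)
  hence "0 < 1 / q" using assms(5) by (simp add: \<gamma>_def)
  hence q: "0 < q" by simp
  have \<gamma>: "0 < \<gamma>" using assms(1) by (simp add: \<gamma>_def)
  have g_eq: "\<gamma> = 1 / p - 1 / q" using assms(5) by (simp add: \<gamma>_def)
  hence "1 / q < 1 / p" using \<gamma> by simp
  hence s: "1 < s" using q assms(3) by (simp add: s_def field_simps)

  \<comment> \<open>the value 1 on the exceptional null set keeps \<open>v\<close> positive everywhere\<close>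
  define v where "v x = (if 0 < w x \<and> w x < \<infinity> then enn2real (w x) powr p else 1)" for x
  have [measurable]: "w \<in> borel_measurable lebesgue" using assms(6) by (simp add: weight_def)
  have v_meas: "v \<in> borel_measurable lebesgue" unfolding v_def by measurable
  have v_pos: "0 < v x" for x by (auto simp: v_def enn2real_positive_iff enn2real_eq_0_iff)
  have w_AE: "AE x in lebesgue. 0 < w x \<and> w x < \<infinity>" using assms(6) by (simp add: weight_def)
  have v_AE: "AE x in lebesgue. epowr (w x) p = ennreal (v x)"
    using w_AE by eventually_elim (auto simp: v_def epowr_def)
  have vs_AE: "AE x in lebesgue. epowr (w x) q = ennreal (v x powr s)"
    using w_AE by eventually_elim (use assms(3) in \<open>auto simp: v_def epowr_def powr_powr s_def\<close>)
  obtain A where "reverse_holder_weight v s A"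
    using RH_imp_reverse_holder_weight[OF assms(7)[folded s_def] s v_meas v_pos v_AE] by blast
  then interpret reverse_holder_weight v s A .

  let ?T = "total_const p q"
  have T: "0 \<le> ?T" using grid_const_nonneg[OF assms(3) q] by (simp add: total_const_def)
  \<comment> \<open>the summand 1 makes \<open>C\<close> positive, which matters when the right-hand norm is infinite\<close>
  define C where "C = ?T powr (1 / q) + 1"
  have C: "0 < C" by (simp add: C_def add_nonneg_pos)
  show ?thesis
  proof (intro exI[of _ C] allI impI)
    fix K :: "nat set" and Q :: "nat \<Rightarrow> (real ^ 'n) set" and c :: "nat \<Rightarrow> real"
    assume KQ: "\<forall>k\<in>K. is_cube (Q k) \<and> 0 < c k"
    hence "\<forall>k\<in>K. \<exists>a l. 0 < l \<and> Q k = cbox a (a + (\<chi> i. l))" by (simp add: is_cube_def)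
    then obtain a l where al: "\<And>k. k \<in> K \<Longrightarrow> 0 < l k" "\<And>k. k \<in> K \<Longrightarrow> Q k = cbox (a k) (a k + (\<chi> i. l k))"
      by metis
    have c: "0 < c k" if "k \<in> K" for k using KQ that by simp
    have Q_sets: "Q k \<in> sets lebesgue" if "k \<in> K" for k using al(2)[OF that] by simp
    let ?f = "\<lambda>x. \<Sum>\<^sub>\<infinity>k\<in>K. ennreal (c k * indicator (Q k) x)"
    let ?F = "\<lambda>x. \<Sum>\<^sub>\<infinity>k\<in>K. ennreal (c k * measure lebesgue (Q k) powr \<gamma> * indicator (Q k) x)"
    have f_eq: "(\<integral>\<^sup>+x. epowr (?f x) p * epowr (w x) p \<partial>lebesgue) = (\<integral>\<^sup>+x. ennreal (v x) * epowr (?f x) p \<partial>lebesgue)"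
      using v_AE by (intro nn_integral_cong_AE) (auto simp: mult.commute)
    have F_eq: "(\<integral>\<^sup>+x. epowr (?F x) q * epowr (w x) q \<partial>lebesgue) = (\<integral>\<^sup>+x. ennreal (v x powr s) * epowr (?F x) q \<partial>lebesgue)"
      using vs_AE by (intro nn_integral_cong_AE) (auto simp: mult.commute)
    have "Lp_norm q (\<lambda>x. epowr (w x) q) ?F \<le> ennreal C * Lp_norm p (\<lambda>x. epowr (w x) p) ?f"
    proof (cases "\<integral>\<^sup>+x. epowr (?f x) p * epowr (w x) p \<partial>lebesgue")
      case top
      hence "Lp_norm p (\<lambda>x. epowr (w x) p) ?f = \<infinity>" by (simp add: Lp_norm_def epowr_def)
      thus ?thesis using C by (simp add: ennreal_mult_top)
    next
      case (real N)
      let ?g = "\<lambda>k x. c k * indicator (Q k) x :: real"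
      let ?G = "\<lambda>k x. c k * measure lebesgue (Q k) powr \<gamma> * indicator (Q k) x"
      have g: "0 \<le> ?g k x" "?g k \<in> borel_measurable lebesgue" "0 \<le> ?G k x" "?G k \<in> borel_measurable lebesgue"
        if k: "k \<in> K" for k x
        using c[OF k] Q_sets[OF k]
        by (auto intro!: mult_nonneg_nonneg borel_measurable_times borel_measurable_indicator intro: less_imp_le)
      have f_le: "(\<integral>\<^sup>+x. ennreal ((\<Sum>k\<in>K \<inter> {..<i}. ?g k x) powr p) \<partial>V) \<le> ennreal N" for i
      proof -
        have meas: "(\<lambda>x. ennreal ((\<Sum>k\<in>K \<inter> {..<i}. ?g k x) powr p)) \<in> borel_measurable lebesgue"
          using Q_sets by (intro measurable_sum_indicator_powr) auto
        have "(\<integral>\<^sup>+x. ennreal ((\<Sum>k\<in>K \<inter> {..<i}. ?g k x) powr p) \<partial>V)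
            = (\<integral>\<^sup>+x. ennreal (v x) * ennreal ((\<Sum>k\<in>K \<inter> {..<i}. ?g k x) powr p) \<partial>lebesgue)"
          unfolding V_def by (rule nn_integral_density[OF _ meas]) measurable
        also have "\<dots> \<le> (\<integral>\<^sup>+x. ennreal (v x) * epowr (?f x) p \<partial>lebesgue)"
          using g(1) assms(3) by (intro nn_integral_mono mult_left_mono sum_powr_le_epowr_infsum) auto
        also have "\<dots> = ennreal N" using real(2) f_eq by simp
        finally show ?thesis .
      qed
      have F_le: "(\<integral>\<^sup>+x. ennreal ((\<Sum>k\<in>K \<inter> {..<i}. ?G k x) powr q) \<partial>U) \<le> ennreal (?T * N powr s)" for i
      proof -
        let ?Q = "\<lambda>k. cbox (a k) (a k + (\<chi> i. l k))"
        have eq: "(\<Sum>k\<in>K \<inter> {..<i}. ?g k x) = (\<Sum>k\<in>K \<inter> {..<i}. c k * indicator (?Q k) x)"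
          "(\<Sum>k\<in>K \<inter> {..<i}. ?G k x)
            = (\<Sum>k\<in>K \<inter> {..<i}. c k * measure lebesgue (?Q k) powr \<gamma> * indicator (?Q k) x)" for x
          using al(2) by (auto intro!: sum.cong)
        show ?thesis
          unfolding eq
        proof (rule finite_sum_of_cubes[OF _ _ _ assms(3) q s_def g_eq real(1)])
          show "(\<integral>\<^sup>+x. ennreal ((\<Sum>k\<in>K \<inter> {..<i}. c k * indicator (?Q k) x) powr p) \<partial>V) \<le> ennreal N"
            using f_le[of i] unfolding eq .
          show "finite (K \<inter> {..<i})" by simp
          show "0 < c k" "0 < l k" if "k \<in> K \<inter> {..<i}" for k
            using c[of k] al(1)[of k] that by simp_all
        qed
      qed
      have G_U: "?G k \<in> borel_measurable U" if "k \<in> K" for k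
        using g(4)[OF that] unfolding measurable_cong_sets[OF sets_VU(2) refl] .
      have "(\<integral>\<^sup>+x. epowr (?F x) q * epowr (w x) q \<partial>lebesgue) = (\<integral>\<^sup>+x. epowr (?F x) q \<partial>U)"
        unfolding F_eq U_def
      proof (rule nn_integral_density[symmetric])
        show "(\<lambda>x. epowr (?F x) q) \<in> borel_measurable lebesgue"
          by (rule measurable_epowr_infsum[OF g(3,4)])
        show "(\<lambda>x. ennreal (v x powr s)) \<in> borel_measurable lebesgue" by measurable
      qed
      also have "\<dots> \<le> ennreal (?T * N powr s)"
        by (rule infsum_powr_weighted_le[OF g(3) G_U q F_le])
      finally have "Lp_norm q (\<lambda>x. epowr (w x) q) ?F \<le> epowr (ennreal (?T * N powr s)) (1 / q)"
        unfolding Lp_norm_def using q by (intro epowr_mono) auto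
      also have "\<dots> = ennreal (?T powr (1 / q) * N powr (1 / p))"
      proof -
        have "s * (1 / q) = 1 / p" using q by (simp add: s_def)
        thus ?thesis using T by (simp add: epowr_ennreal powr_mult powr_powr)
      qed
      also have "\<dots> \<le> ennreal (C * N powr (1 / p))"
        by (intro ennreal_leI mult_right_mono) (auto simp: C_def)
      also have "\<dots> = ennreal C * ennreal (N powr (1 / p))"
        using C by (intro ennreal_mult) auto
      also have "ennreal (N powr (1 / p)) = Lp_norm p (\<lambda>x. epowr (w x) p) ?f"
        unfolding Lp_norm_def real(2) using real(1) by (simp add: epowr_ennreal)
      finally show ?thesis .
    qed
    thus "Lp_norm q (\<lambda>x. epowr (w x) q)
        (\<lambda>x. \<Sum>\<^sub>\<infinity>k\<in>K. ennreal (c k * measure lebesgue (Q k) powr (\<alpha> / real CARD('n)) * indicator (Q k) x))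
      \<le> ennreal C * Lp_norm p (\<lambda>x. epowr (w x) p)
        (\<lambda>x. \<Sum>\<^sub>\<infinity>k\<in>K. ennreal (c k * indicator (Q k) x))"
      unfolding \<gamma>_def .
  qed
qed

end
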